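(* Let $(X,\rho,\mu)$ be a space of homogeneous type and let $w$ be a weight on $X$. The following three conditions are equivalent: (1) $w \in A_\infty^{\mathrm{weak}}$; (2) $w \in \mathscr{A}_\infty^{\mathrm{weak}}$; (3) $w \in RH_q^{\mathrm{weak}}$ for some $q > 1$.
   Context: A space of homogeneous type $(X,\rho,\mu)$: $\rho$ is a quasi-metric, i.e. it satisfies the axioms of a metric except that the triangle inequality is replaced by $\rho(x,y)\le \kappa(\rho(x,z)+\rho(z,y))$ for some $\kappa\ge 1$; $\mu$ is a Borel measure with $0<\mu(B)<\infty$ for balls $B$ and $\mu(B(x,2r))\le D\mu(B(x,r))$ for every ball $B(x,r)=\{y: \rho(x,y)<r\}$. All balls are assumed to be Borel sets. For $B=B(x,r)$, $\lambda B = B(x,\lambda r)$. A weight is a nonnegative measurable function $w$ on $X$; $w(E)=\int_E w\,d\mu$. $A_\infty^{\mathrm{weak}}$: let $Mf(x)=\sup_{B\ni x}\frac{1}{\mu(B)}\int_B |f|\,d\mu$ (supremum over balls containing $x$). For $\sigma\ge1$, $w\in A_\infty^\sigma$ if $\sup_B \frac{1}{w(\sigma B)}\int_B M(1_B w)\,d\mu<\infty$, i.e. there is a finite $C$ with $\int_B M(1_Bw)\,d\mu\le C\,w(\sigma B)$ for all balls $B$. $w\in A_\infty^{\mathrm{weak}}$ if $w\in A_\infty^\sigma$ for some $\sigma>\kappa$. $\mathscr{A}_\infty^{\mathrm{weak}}$: for $\sigma\ge 1$, $w\in\mathscr{A}_\infty^\sigma$ if there exist constants $C>0$ and $p\ge1$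 such that for every ball $B$ and every measurable set $E\subseteq B$, $\frac{w(E)}{w(\sigma B)}\le C\left(\frac{\mu(E)}{\mu(B)}\right)^{1/p}$ (read as $w(E)\le C(\mu(E)/\mu(B))^{1/p}w(\sigma B)$). $w\in\mathscr{A}_\infty^{\mathrm{weak}}$ if $w\in\mathscr{A}_\infty^\sigma$ for some $\sigma>\kappa$. $RH_q^{\mathrm{weak}}$: for $\sigma\ge 1$, $q>1$, $w\in RH_q^\sigma$ if there is a finite constant $C$ with $\left(\frac{1}{\mu(B)}\int_B w^q\,d\mu\right)^{1/q}\le C\,\frac{1}{\mu(\sigma B)}\int_{\sigma B}w\,d\mu$ for every ball $B$. $w\in RH_q^{\mathrm{weak}}$ if $w\in RH_q^\sigma$ for some $\sigma>\kappa$. *)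

theory Defs
  imports "HOL-Analysis.Analysis"
begin

section \<open>Spaces of homogeneous type\<close>

definition qball :: "'a set \<Rightarrow> ('a \<Rightarrow> 'a \<Rightarrow> real) \<Rightarrow> 'a \<Rightarrow> real \<Rightarrow> 'a set" where
  "qball X \<rho> x r = {y \<in> X. \<rho> x y < r}"

text \<open>
  Balls of a quasi-metric need not be open. A set is open if it contains a ball around each of its
  points; Borel sets refer to this topology.
\<close>

definition quasi_metric_topology :: "'a set \<Rightarrow> ('a \<Rightarrow> 'a \<Rightarrow> real) \<Rightarrow> 'a topology" where
  "quasi_metric_topology X \<rho> =
     topology (\<lambda>U. U \<subseteq> X \<and> (\<forall>x\<in>U. \<exists>r>0. qball X \<rho> x r \<subseteq> U))"

lemma openin_quasi_metric_topology:
  "openin (quasi_metric_topology X \<rho>) U \<longleftrightarrow>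
     U \<subseteq> X \<and> (\<forall>x\<in>U. \<exists>r>0. qball X \<rho> x r \<subseteq> U)"
proof -
  have "istopology (\<lambda>U. U \<subseteq> X \<and> (\<forall>x\<in>U. \<exists>r>0. qball X \<rho> x r \<subseteq> U))"
    unfolding istopology_def
  proof (intro conjI allI impI, goal_cases)
    case (1 S T)
    then show ?case by auto
  next
    case (2 S T)
    show ?case
    proof
      fix x assume x: "x \<in> S \<inter> T"
      from 2 x obtain r where r: "r > 0" "qball X \<rho> x r \<subseteq> S" by auto
      from 2 x obtain s where s: "s > 0" "qball X \<rho> x s \<subseteq> T" by auto
      have "qball X \<rho> x (min r s) \<subseteq> S \<inter> T"
        using r s by (auto simp: qball_def)
      with r s show "\<exists>r>0. qball X \<rho> x r \<subseteq> S \<inter> T"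
        by (intro exI[of _ "min r s"]) auto
    qed
  next
    case (3 K)
    then show ?case by auto
  next
    case (4 K)
    then show ?case by (meson UnionE Union_upper subset_trans)
  qed
  then show ?thesis
    by (simp add: quasi_metric_topology_def)
qed

locale quasi_metric =
  fixes X :: "'a set" and \<rho> :: "'a \<Rightarrow> 'a \<Rightarrow> real" and \<kappa> :: real
  assumes kappa_ge_1: "1 \<le> \<kappa>"
    and nonneg: "\<lbrakk>x \<in> X; y \<in> X\<rbrakk> \<Longrightarrow> 0 \<le> \<rho> x y"
    and zero: "\<lbrakk>x \<in> X; y \<in> X\<rbrakk> \<Longrightarrow> \<rho> x y = 0 \<longleftrightarrow> x = y"
    and commute: "\<lbrakk>x \<in> X; y \<in> X\<rbrakk> \<Longrightarrow> \<rho> x y = \<rho> y x"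
    and quasi_triangle: "\<lbrakk>x \<in> X; y \<in> X; z \<in> X\<rbrakk> \<Longrightarrow> \<rho> x y \<le> \<kappa> * (\<rho> x z + \<rho> z y)"

text \<open>The underlying set is the space of the measure.\<close>

locale homogeneous_type = quasi_metric "space M" \<rho> \<kappa>
  for M :: "'a measure" and \<rho> :: "'a \<Rightarrow> 'a \<Rightarrow> real" and \<kappa> :: real +
  assumes borel:
      "sets M = sigma_sets (space M) {U. openin (quasi_metric_topology (space M) \<rho>) U}"
    and ball_measurable: "\<lbrakk>x \<in> space M; 0 < r\<rbrakk> \<Longrightarrow> qball (space M) \<rho> x r \<in> sets M"
    and ball_pos: "\<lbrakk>x \<in> space M; 0 < r\<rbrakk> \<Longrightarrow> 0 < emeasure M (qball (space M) \<rho> x r)"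
    and ball_finite: "\<lbrakk>x \<in> space M; 0 < r\<rbrakk> \<Longrightarrow> emeasure M (qball (space M) \<rho> x r) < \<infinity>"
    and doubling: "\<exists>D::real. \<forall>x\<in>space M. \<forall>r>0.
      emeasure M (qball (space M) \<rho> x (2 * r)) \<le> ennreal D * emeasure M (qball (space M) \<rho> x r)"


section \<open>Weights and the maximal function\<close>

definition weight :: "'a measure \<Rightarrow> ('a \<Rightarrow> real) \<Rightarrow> bool" where
  "weight M w \<longleftrightarrow> w \<in> borel_measurable M \<and> (\<forall>x\<in>space M. 0 \<le> w x)"

definition weight_measure :: "'a measure \<Rightarrow> ('a \<Rightarrow> real) \<Rightarrow> 'a set \<Rightarrow> ennreal" where
  "weight_measure M w E = (\<integral>\<^sup>+x\<in>E. ennreal (w x) \<partial>M)"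

definition maximal :: "'a measure \<Rightarrow> ('a \<Rightarrow> 'a \<Rightarrow> real) \<Rightarrow> ('a \<Rightarrow> real) \<Rightarrow> 'a \<Rightarrow> ennreal" where
  "maximal M \<rho> f x =
     (SUP (c, r) \<in> {(c, r). c \<in> space M \<and> 0 < r \<and> x \<in> qball (space M) \<rho> c r}.
        (\<integral>\<^sup>+y\<in>qball (space M) \<rho> c r. ennreal \<bar>f y\<bar> \<partial>M) / emeasure M (qball (space M) \<rho> c r))"


section \<open>The three classes\<close>

text \<open>
  A ball is given by its centre and radius, since its dilates depend on these. Weights need not be
  locally integrable, so integrals take values in \<open>[0, \<infinity>]\<close>. Ratio conditions are written in
  multiplied-out form, which covers balls of weight \<open>0\<close> or \<open>\<infinity>\<close>.
\<close>

text \<open>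
  The maximal function need not be measurable, as balls need not be open; the nonnegative integral
  is then the supremum over measurable simple functions below it. Any other reading of the integral
  gives the same class, because the maximal function is comparable, by doubling, to its lower
  semicontinuous variant over balls having the point in their interior.
\<close>

definition A_infty ::
  "'a measure \<Rightarrow> ('a \<Rightarrow> 'a \<Rightarrow> real) \<Rightarrow> real \<Rightarrow> ('a \<Rightarrow> real) set" where
  "A_infty M \<rho> \<sigma> = {w. weight M w \<and>
     (\<exists>C::real. \<forall>c\<in>space M. \<forall>r>0.
        (\<integral>\<^sup>+x\<in>qball (space M) \<rho> c r.
            maximal M \<rho> (\<lambda>y. indicator (qball (space M) \<rho> c r) y * w y) x \<partial>M)
          \<le> ennreal C * weight_measure M w (qball (space M) \<rho> c (\<sigma> * r)))}"

definition A_infty_weak ::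
  "'a measure \<Rightarrow> ('a \<Rightarrow> 'a \<Rightarrow> real) \<Rightarrow> real \<Rightarrow> ('a \<Rightarrow> real) set" where
  "A_infty_weak M \<rho> \<kappa> = (\<Union>\<sigma>\<in>{\<kappa><..}. A_infty M \<rho> \<sigma>)"

definition script_A_infty ::
  "'a measure \<Rightarrow> ('a \<Rightarrow> 'a \<Rightarrow> real) \<Rightarrow> real \<Rightarrow> ('a \<Rightarrow> real) set" where
  "script_A_infty M \<rho> \<sigma> = {w. weight M w \<and>
     (\<exists>C>0::real. \<exists>p\<ge>1::real. \<forall>c\<in>space M. \<forall>r>0.
        \<forall>E\<in>sets M. E \<subseteq> qball (space M) \<rho> c r \<longrightarrow>
          weight_measure M w E
            \<le> ennreal (C * (measure M E / measure M (qball (space M) \<rho> c r)) powr (1 / p))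
               * weight_measure M w (qball (space M) \<rho> c (\<sigma> * r)))}"

definition script_A_infty_weak ::
  "'a measure \<Rightarrow> ('a \<Rightarrow> 'a \<Rightarrow> real) \<Rightarrow> real \<Rightarrow> ('a \<Rightarrow> real) set" where
  "script_A_infty_weak M \<rho> \<kappa> = (\<Union>\<sigma>\<in>{\<kappa><..}. script_A_infty M \<rho> \<sigma>)"

text \<open>Real powers on \<open>[0, \<infinity>]\<close>, used only for positive exponents.\<close>

definition ennreal_powr :: "ennreal \<Rightarrow> real \<Rightarrow> ennreal" where
  "ennreal_powr x a = (if x = \<infinity> then \<infinity> else ennreal (enn2real x powr a))"

definition RH ::
  "'a measure \<Rightarrow> ('a \<Rightarrow> 'a \<Rightarrow> real) \<Rightarrow> real \<Rightarrow> real \<Rightarrow> ('a \<Rightarrow> real) set" where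
  "RH M \<rho> q \<sigma> = {w. weight M w \<and>
     (\<exists>C::real. \<forall>c\<in>space M. \<forall>r>0.
        ennreal_powr
          ((\<integral>\<^sup>+x\<in>qball (space M) \<rho> c r. ennreal (w x powr q) \<partial>M)
             / emeasure M (qball (space M) \<rho> c r)) (1 / q)
          \<le> ennreal C * ((\<integral>\<^sup>+x\<in>qball (space M) \<rho> c (\<sigma> * r). ennreal (w x) \<partial>M)
               / emeasure M (qball (space M) \<rho> c (\<sigma> * r))))}"

definition RH_weak ::
  "'a measure \<Rightarrow> ('a \<Rightarrow> 'a \<Rightarrow> real) \<Rightarrow> real \<Rightarrow> real \<Rightarrow> ('a \<Rightarrow> real) set" where
  "RH_weak M \<rho> \<kappa> q = (\<Union>\<sigma>\<in>{\<kappa><..}. RH M \<rho> q \<sigma>)"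

end

theory Submission
  imports Defs
begin

text \<open>
  Each of the three conditions is equivalent to exponential decay of the level sets of \<open>w\<close>: for
  some \<open>\<sigma>\<close>, \<open>C\<close> and \<open>b > 1\<close>, the part of a ball \<open>B\<close> where \<open>w > C b\<^sup>k w(\<sigma>B)/\<mu>(B)\<close> has
  \<open>w\<close>-mass at most \<open>2\<^sup>-\<^sup>k w(\<sigma>B)\<close>. Given the decay, a reverse Hoelder inequality and the power bound
  on \<open>w(E)\<close> result from summing over the levels, and the integral of the maximal function is
  controlled by its weak type inequality; Chebyshev's inequality gives the decay back from the first
  two. The main point is the decay for \<open>w\<close> in \<open>A\<^sub>\<infinity>\<close>: stopping balls give a reverse weak type
  inequality, so summing over \<open>N\<close> levels shows that the mass above a high level is at most
  \<open>C/N\<close> of the total, and this gain is iterated from level to level through stopping balls. Lebesgue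
  differentiation is needed only up to a constant factor, where the basic covering lemma and outer
  regularity suffice.
\<close>

text \<open>The obstacle is that \<open>\<nu>\<close> need not be doubling, so the mass of an
  enlarged ball cannot in general be bounded by the mass of the ball. The choice of stopping radii
  replaces doubling: they are maximal up to a factor 2, so concentric larger balls, up to a fixed
  radius, have small averages, and every enlargement is charged to \<open>M\<close>, which is
  doubling. Since level sets of the maximal function may fail to be measurable, countable unions of
  balls stand in for them. Decay survives an increase of \<sigma>, so it can be converted into each
  condition with \<sigma> as large as desired; the exponents p and q are encoded in the base b
  alone.\<close>

lemma ex_power_between:
  fixes q y :: real
  assumes "1 < q" "1 \<le> y"
  obtains k where "q ^ k \<le> y" "y < q ^ Suc k"
proof -
  obtain n where "y < q ^ n" using real_arch_pow[OF assms(1)] by blast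
  then have "\<exists>k<n. (\<forall>i\<le>k. \<not> y < q ^ i) \<and> y < q ^ Suc k"
    using assms by (intro ex_least_nat_less[of "\<lambda>k. y < q ^ k"]) auto
  then show ?thesis using that by (auto simp: not_less)
qed

section \<open>Countable unions and disjoint families\<close>

lemma emeasure_UN_le_nn_integral:
  assumes I: "countable I" and Y: "\<And>i. i \<in> I \<Longrightarrow> Y i \<in> sets N"
  shows "emeasure N (\<Union>i\<in>I. Y i) \<le> (\<integral>\<^sup>+i. emeasure N (Y i) \<partial>count_space I)"
proof -
  have m: "(\<Union>i\<in>I. Y i) \<in> sets N" using I Y by (intro sets.countable_UN') auto
  have "emeasure N (\<Union>i\<in>I. Y i) = (\<integral>\<^sup>+x. indicator (\<Union>i\<in>I. Y i) x \<partial>N)"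
    using m by simp
  also have "\<dots> \<le> (\<integral>\<^sup>+x. \<integral>\<^sup>+i. indicator (Y i) x \<partial>count_space I \<partial>N)"
  proof (intro nn_integral_mono)
    fix x
    show "indicator (\<Union>i\<in>I. Y i) x \<le> (\<integral>\<^sup>+i. indicator (Y i) x \<partial>count_space I)"
    proof (cases "x \<in> (\<Union>i\<in>I. Y i)")
      case True
      then obtain j where j: "j \<in> I" "x \<in> Y j" by auto
      have "indicator (Y j) x \<le> (\<integral>\<^sup>+i. indicator (Y i) x \<partial>count_space I)"
        by (rule nn_integral_ge_point[OF j(1)])
      then show ?thesis using j True by simp
    qed simp
  qed
  also have "\<dots> = (\<integral>\<^sup>+i. \<integral>\<^sup>+x. indicator (Y i) x \<partial>N \<partial>count_space I)"
    using I Y by (intro nn_integral_count_space_nn_integral) auto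
  also have "\<dots> = (\<integral>\<^sup>+i. emeasure N (Y i) \<partial>count_space I)"
    using Y by (intro nn_integral_cong) auto
  finally show ?thesis .
qed

text \<open>Passes from estimates for single balls to unions. The sets \<open>Y i\<close>, typically
  parts of dilated balls, may overlap; only the \<open>Z i\<close>, parts of the selected balls, are
  disjoint. Two measures are allowed because \<open>M\<close> and \<open>\<nu>\<close> are compared
  in both directions.\<close>

lemma emeasure_UN_le_disjoint:
  assumes I: "countable I" and Y: "\<And>i. i \<in> I \<Longrightarrow> Y i \<in> sets N" and Z: "\<And>i. i \<in> I \<Longrightarrow> Z i \<in> sets P"
    and disj: "disjoint_family_on Z I"
    and le: "\<And>i. i \<in> I \<Longrightarrow> emeasure N (Y i) \<le> K * emeasure P (Z i)"
  shows "emeasure N (\<Union>i\<in>I. Y i) \<le> K * emeasure P (\<Union>i\<in>I. Z i)"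
proof -
  have "emeasure N (\<Union>i\<in>I. Y i) \<le> (\<integral>\<^sup>+i. emeasure N (Y i) \<partial>count_space I)"
    by (rule emeasure_UN_le_nn_integral[OF I Y])
  also have "\<dots> \<le> (\<integral>\<^sup>+i. K * emeasure P (Z i) \<partial>count_space I)"
    using le by (intro nn_integral_mono) auto
  also have "\<dots> = K * (\<integral>\<^sup>+i. emeasure P (Z i) \<partial>count_space I)"
    by (rule nn_integral_cmult) auto
  also have "(\<integral>\<^sup>+i. emeasure P (Z i) \<partial>count_space I) = emeasure P (\<Union>i\<in>I. Z i)"
    using I Z disj by (subst emeasure_UN_countable) auto
  finally show ?thesis .
qed

text \<open>Finite partial sums of the measures are bounded by the measure of \<open>V\<close>, so
  the family is summable and has only countably many nonzero terms.\<close>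

lemma countable_disjoint_positive_measure:
  assumes Z: "\<And>i. i \<in> I \<Longrightarrow> Z i \<in> sets N" "\<And>i. i \<in> I \<Longrightarrow> Z i \<subseteq> V"
    and V: "V \<in> sets N" "emeasure N V < \<infinity>"
    and disj: "disjoint_family_on Z I" and pos: "\<And>i. i \<in> I \<Longrightarrow> 0 < emeasure N (Z i)"
  shows "countable I"
proof -
  have fin: "emeasure N (Z i) \<noteq> \<infinity>" if "i \<in> I" for i
    using emeasure_mono[OF Z(2)[OF that] V(1)] V(2) by (auto simp: top_unique)
  have "(\<lambda>i. measure N (Z i)) summable_on I"
  proof (rule nonneg_bdd_above_summable_on)
    show "bdd_above (sum (\<lambda>i. measure N (Z i)) ` {F. F \<subseteq> I \<and> finite F})"
    proof (rule bdd_aboveI2)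
      fix F assume F: "F \<in> {F. F \<subseteq> I \<and> finite F}"
      then have "(\<Sum>i\<in>F. measure N (Z i)) = measure N (\<Union>i\<in>F. Z i)"
        using Z(1) disj fin
        by (intro measure_finite_Union[symmetric]) (auto intro: disjoint_family_on_mono)
      also have "\<dots> \<le> measure N V"
        using F Z V by (intro measure_mono_fmeasurable fmeasurableI sets.finite_UN) auto
      finally show "(\<Sum>i\<in>F. measure N (Z i)) \<le> measure N V" .
    qed
  qed auto
  then have "(\<lambda>i. norm (measure N (Z i))) summable_on I"
    by simp
  then have "countable {i\<in>I. measure N (Z i) \<noteq> 0}"
    using abs_summable_countable[of "\<lambda>i. measure N (Z i)" I]
    by (simp)
  moreover have "{i\<in>I. measure N (Z i) \<noteq> 0} = I"
    using pos fin by (force simp: measure_def enn2real_eq_0_iff)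
  ultimately show ?thesis by simp
qed

section \<open>Balls and the covering lemma\<close>

context homogeneous_type
begin

abbreviation "B \<equiv> qball (space M) \<rho>"

lemma kappa_pos: "0 < \<kappa>"
  using kappa_ge_1 by simp

lemma B_mono: "r \<le> s \<Longrightarrow> B c r \<subseteq> B c s"
  by (auto simp: qball_def)

lemma B_subset_space: "B c r \<subseteq> space M"
  by (auto simp: qball_def)

lemma centre_in_B: "c \<in> space M \<Longrightarrow> 0 < r \<Longrightarrow> c \<in> B c r"
  using zero[of c c] by (auto simp: qball_def)

lemma B_in_sets [measurable]: "c \<in> space M \<Longrightarrow> B c r \<in> sets M"
  using ball_measurable[of c r] nonneg[of c]
  by (cases "0 < r") (force simp: qball_def, metis (mono_tags, lifting) Collect_empty_eq not_less
      order.strict_trans1 qball_def sets.empty_sets)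

lemma B_subset_B:
  assumes "x \<in> space M" "y \<in> B x d" "\<kappa> * (d + r) \<le> s"
  shows "B y r \<subseteq> B x s"
proof
  fix z assume z: "z \<in> B y r"
  have "\<rho> x z \<le> \<kappa> * (\<rho> x y + \<rho> y z)"
    using assms z by (intro quasi_triangle) (auto simp: qball_def)
  also have "\<dots> < \<kappa> * (d + r)"
    using assms z kappa_pos by (intro mult_strict_left_mono add_strict_mono) (auto simp: qball_def)
  finally show "z \<in> B x s" using assms z by (auto simp: qball_def)
qed

lemma B_finite: "c \<in> space M \<Longrightarrow> emeasure M (B c r) < top"
  using ball_finite[of c r] emeasure_mono[OF B_mono[of r 1 c], of M] ball_finite[of c 1]
  by (cases "0 < r") (auto intro: le_less_trans)

lemma B_sym: "x \<in> space M \<Longrightarrow> y \<in> B x r \<longleftrightarrow> y \<in> space M \<and> x \<in> B y r"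
  using commute[of x y] by (auto simp: qball_def)

section \<open>Doubling for arbitrary dilation factors\<close>

lemma ex_dilation:
  "\<exists>D\<ge>1. \<forall>c\<in>space M. \<forall>r>0. emeasure M (B c (L * r)) \<le> ennreal D * emeasure M (B c r)"
proof -
  obtain D0 where D0: "\<And>c r. c \<in> space M \<Longrightarrow> r > 0 \<Longrightarrow>
      emeasure M (B c (2 * r)) \<le> ennreal D0 * emeasure M (B c r)"
    using doubling by blast
  define D where "D = max 1 D0"
  have D: "emeasure M (B c (2 * r)) \<le> ennreal D * emeasure M (B c r)" if "c \<in> space M" "r > 0" for c r
    using D0[OF that] by (rule order.trans) (auto simp: D_def intro!: mult_right_mono ennreal_leI)
  have it: "emeasure M (B c (2 ^ n * r)) \<le> ennreal (D ^ n) * emeasure M (B c r)"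
    if "c \<in> space M" "r > 0" for c r n
  proof (induction n)
    case (Suc n)
    have "emeasure M (B c (2 ^ Suc n * r)) \<le> ennreal D * emeasure M (B c (2 ^ n * r))"
      using D[of c "2 ^ n * r"] that by (simp add: mult.assoc)
    also have "\<dots> \<le> ennreal D * (ennreal (D ^ n) * emeasure M (B c r))"
      by (intro mult_left_mono Suc) auto
    finally show ?case by (simp add: D_def ennreal_mult mult.assoc)
  qed simp
  obtain n where n: "L \<le> 2 ^ n"
    using real_arch_pow[of 2 L] by (auto intro: less_imp_le)
  have "emeasure M (B c (L * r)) \<le> ennreal (D ^ n) * emeasure M (B c r)"
    if "c \<in> space M" "r > 0" for c r
    using that n by (intro order.trans[OF emeasure_mono it] B_mono mult_right_mono) auto
  moreover have "D ^ n \<ge> 1" by (simp add: D_def)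
  ultimately show ?thesis by blast
qed

text \<open>A constant is chosen once for each factor, independently of the ball, so that later
  statements can name it in their hypotheses and bounds.\<close>

definition dilation_const :: "real \<Rightarrow> real" where
  "dilation_const L =
     (SOME D. D \<ge> 1 \<and> (\<forall>c\<in>space M. \<forall>r>0. emeasure M (B c (L * r)) \<le> ennreal D * emeasure M (B c r)))"

lemma dilation_const_ge_1: "1 \<le> dilation_const L"
  and emeasure_dilation: "c \<in> space M \<Longrightarrow> 0 < r \<Longrightarrow>
      emeasure M (B c (L * r)) \<le> ennreal (dilation_const L) * emeasure M (B c r)"
  using someI_ex[OF ex_dilation, folded dilation_const_def] by blast+

lemma emeasure_B: "c \<in> space M \<Longrightarrow> emeasure M (B c r) = ennreal (measure M (B c r))"
  using B_finite[of c r] by (intro emeasure_eq_ennreal_measure) auto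

lemma measure_B_pos: "c \<in> space M \<Longrightarrow> 0 < r \<Longrightarrow> 0 < measure M (B c r)"
  using ball_pos[of c r] by (simp add: emeasure_B)

lemma measure_dilation:
  "c \<in> space M \<Longrightarrow> 0 < r \<Longrightarrow> measure M (B c (q * r)) \<le> dilation_const q * measure M (B c r)"
  using emeasure_dilation[of c r q] dilation_const_ge_1[of q]
  by (simp add: emeasure_B flip: ennreal_mult)

lemma measure_dilation_power:
  assumes "c \<in> space M" "0 < r" "0 < q"
  shows "measure M (B c (q ^ k * r)) \<le> dilation_const q ^ k * measure M (B c r)"
proof (induction k)
  case (Suc k)
  have "measure M (B c (q * (q ^ k * r))) \<le> dilation_const q * measure M (B c (q ^ k * r))"
    using assms by (intro measure_dilation) auto
  also have "\<dots> \<le> dilation_const q * (dilation_const q ^ k * measure M (B c r))"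
    using Suc dilation_const_ge_1[of q] by (intro mult_left_mono) auto
  finally show ?case by (simp add: mult.assoc)
qed simp

lemma measure_B_mono: "c \<in> space M \<Longrightarrow> x \<in> space M \<Longrightarrow> B c r \<subseteq> B x s \<Longrightarrow> measure M (B c r) \<le> measure M (B x s)"
  using B_finite[of x s] by (intro measure_mono_fmeasurable fmeasurableI) auto

text \<open>The factor needed when two balls meet and r \<le> 2s: seen from a common point the first
  ball lies in radius 2\<kappa>r, and \<kappa>(s + 2\<kappa>r) \<le> \<kappa>(\<kappa>s +
  4\<kappa>s) = 5\<kappa>^2 s. For \<kappa> = 1 it is the classical 5.\<close>

definition vitali_const :: real where
  "vitali_const = 5 * \<kappa>\<^sup>2"

lemma vitali_const_ge: "5 \<le> vitali_const"
  using kappa_ge_1 by (simp add: vitali_const_def)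

text \<open>Zorn's lemma yields a maximal disjoint subfamily such that every ball of
  \<open>F\<close> that meets it meets a member of at least half its radius. If some ball missed the
  whole subfamily, one whose radius exceeds half the supremum over all such balls could be added.
  Disjoint balls have positive measure and lie in \<open>V\<close>, whence countability.\<close>

lemma vitali_covering:
  fixes F :: "('a \<times> real) set"
  assumes F: "\<And>c r. (c, r) \<in> F \<Longrightarrow> c \<in> space M" "\<And>c r. (c, r) \<in> F \<Longrightarrow> 0 < r"
      "\<And>c r. (c, r) \<in> F \<Longrightarrow> r \<le> R" "\<And>c r. (c, r) \<in> F \<Longrightarrow> B c r \<subseteq> V"
    and V: "V \<in> sets M" "emeasure M V < \<infinity>"
  obtains G where "G \<subseteq> F" "countable G" "disjoint_family_on (\<lambda>(c, r). B c r) G"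
    "\<And>c r. (c, r) \<in> F \<Longrightarrow> \<exists>(y, s)\<in>G. B c r \<subseteq> B y (vitali_const * s)"
proof -
  define b where "b = (\<lambda>p::'a \<times> real. B (fst p) (snd p))"
  define \<Omega> where "\<Omega> = {G. G \<subseteq> F \<and> disjoint_family_on b G \<and>
    (\<forall>p\<in>F. (\<exists>q\<in>G. b p \<inter> b q \<noteq> {}) \<longrightarrow> (\<exists>q\<in>G. b p \<inter> b q \<noteq> {} \<and> snd p \<le> 2 * snd q))}"
  have "\<exists>G\<in>\<Omega>. \<forall>H\<in>\<Omega>. G \<subseteq> H \<longrightarrow> H = G"
  proof (rule subset_Zorn_nonempty)
    have "{} \<in> \<Omega>" by (auto simp: \<Omega>_def disjoint_family_on_def)
    then show "\<Omega> \<noteq> {}" by blast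
  next
    fix C assume C: "C \<noteq> {}" "subset.chain \<Omega> C"
    then have sub: "C \<subseteq> \<Omega>" and tot: "\<And>G H. G \<in> C \<Longrightarrow> H \<in> C \<Longrightarrow> G \<subseteq> H \<or> H \<subseteq> G"
      by (auto simp: subset.chain_def)
    have "disjoint_family_on b (\<Union>C)"
      unfolding disjoint_family_on_def
    proof (intro ballI impI)
      fix p q assume "p \<in> \<Union>C" "q \<in> \<Union>C" and ne: "p \<noteq> q"
      then obtain G where "G \<in> C" "p \<in> G" "q \<in> G" using tot by blast
      then show "b p \<inter> b q = {}"
        using sub ne by (auto simp: \<Omega>_def disjoint_family_on_def)
    qed
    moreover have "\<exists>q\<in>\<Union>C. b p \<inter> b q \<noteq> {} \<and> snd p \<le> 2 * snd q"
      if pq: "p \<in> F" "q \<in> \<Union>C" "b p \<inter> b q \<noteq> {}" for p q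
    proof -
      obtain G where G: "G \<in> C" "q \<in> G" using pq by blast
      then have "\<exists>q\<in>G. b p \<inter> b q \<noteq> {} \<and> snd p \<le> 2 * snd q"
        using pq sub unfolding \<Omega>_def by blast
      then show ?thesis using G by blast
    qed
    moreover have "\<Union>C \<subseteq> F" using sub by (auto simp: \<Omega>_def)
    ultimately show "\<Union>C \<in> \<Omega>" unfolding \<Omega>_def by blast
  qed
  then obtain G where G: "G \<in> \<Omega>" and max: "\<And>H. H \<in> \<Omega> \<Longrightarrow> G \<subseteq> H \<Longrightarrow> H = G" by blast
  have GF: "G \<subseteq> F" and disj: "disjoint_family_on b G"
    and big: "\<And>p q. p \<in> F \<Longrightarrow> q \<in> G \<Longrightarrow> b p \<inter> b q \<noteq> {} \<Longrightarrow> \<exists>q\<in>G. b p \<inter> b q \<noteq> {} \<and> snd p \<le> 2 * snd q"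
    using G unfolding \<Omega>_def by blast+
  have meets: "\<exists>q\<in>G. b p \<inter> b q \<noteq> {}" if p: "p \<in> F" for p
  proof (rule ccontr)
    define F' where "F' = {p\<in>F. \<forall>q\<in>G. b p \<inter> b q = {}}"
    assume "\<not> (\<exists>q\<in>G. b p \<inter> b q \<noteq> {})"
    then have pF': "p \<in> F'" using p by (auto simp: F'_def)
    have bdd: "bdd_above (snd ` F')"
      using F(3) by (intro bdd_aboveI[of _ R]) (auto simp: F'_def)
    have "0 < snd p" using p F(2)[of "fst p" "snd p"] by simp
    then have "0 < Sup (snd ` F')"
      using cSup_upper[OF _ bdd, of "snd p"] pF' by auto
    then have "\<exists>x\<in>snd ` F'. Sup (snd ` F') / 2 < x"
      using pF' bdd by (intro less_cSupD) auto
    then obtain q where q: "q \<in> F'" "Sup (snd ` F') / 2 < snd q" by auto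
    have q2: "snd p' \<le> 2 * snd q" if "p' \<in> F'" for p'
      using cSup_upper[OF _ bdd, of "snd p'"] that q by auto
    have qF: "q \<in> F" "\<And>q'. q' \<in> G \<Longrightarrow> b q \<inter> b q' = {}" using q by (auto simp: F'_def)
    have bq: "b q \<noteq> {}"
      using qF F(1,2)[of "fst q" "snd q"] centre_in_B[of "fst q" "snd q"] by (auto simp: b_def)
    have "insert q G \<in> \<Omega>"
      unfolding \<Omega>_def
    \<comment> \<open>A ball missing \<open>G\<close> can meet the enlarged family only in
      \<open>q\<close>, whose radius is large enough by \<open>q2\<close>; a ball meeting
      \<open>G\<close> already has a suitable partner there.\<close>
    proof (intro CollectI conjI ballI impI)
      show "insert q G \<subseteq> F" using GF qF by auto
      show "disjoint_family_on b (insert q G)"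
        using disj qF(2) unfolding disjoint_family_on_def by blast
      fix p' assume p': "p' \<in> F" and "\<exists>q'\<in>insert q G. b p' \<inter> b q' \<noteq> {}"
      show "\<exists>q'\<in>insert q G. b p' \<inter> b q' \<noteq> {} \<and> snd p' \<le> 2 * snd q'"
      proof (cases "p' \<in> F'")
        case True
        then have "b p' \<inter> b q \<noteq> {}"
          using \<open>\<exists>q'\<in>insert q G. b p' \<inter> b q' \<noteq> {}\<close> by (auto simp: F'_def)
        then show ?thesis using q2[OF True] by blast
      next
        case False
        then show ?thesis using big[OF p'] p' by (auto simp: F'_def)
      qed
    qed
    then have "q \<in> G" using max by blast
    then show False using qF(2) bq by blast
  qed
  show thesis
  proof (rule that[OF GF])
    show dj: "disjoint_family_on (\<lambda>(c, r). B c r) G"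
      using disj by (simp add: b_def case_prod_unfold)
    have "b p \<in> sets M" "b p \<subseteq> V" "0 < emeasure M (b p)" if "p \<in> G" for p
      using that GF F[of "fst p" "snd p"] ball_pos[of "fst p" "snd p"] by (auto simp: b_def)
    then show "countable G"
      by (intro countable_disjoint_positive_measure[OF _ _ V disj])
    fix x r assume xr: "(x, r) \<in> F"
    then obtain q where q: "q \<in> G" "b (x, r) \<inter> b q \<noteq> {}" "r \<le> 2 * snd q"
      using meets[OF xr] big[OF xr] by (metis snd_conv)
    obtain y s where ys: "q = (y, s)" by (cases q)
    obtain u where u: "u \<in> B x r" "u \<in> B y s" using q by (auto simp: b_def ys)
    have sp: "x \<in> space M" "y \<in> space M" "0 < s" "0 < r" using xr F q ys GF by auto
    have usp: "u \<in> space M" using u by (auto simp: qball_def)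
    have "B x r \<subseteq> B u (2 * \<kappa> * r)"
      using u sp usp by (intro B_subset_B[where d = r]) (auto simp: B_sym[of u x])
    also have "\<dots> \<subseteq> B y (vitali_const * s)"
    proof (rule B_subset_B[OF sp(2) u(2)])
      have "s + 2 * \<kappa> * r \<le> \<kappa> * s + 2 * \<kappa> * (2 * s)"
        using sp kappa_ge_1 q by (intro add_mono mult_left_mono) (auto simp: ys)
      then have "\<kappa> * (s + 2 * \<kappa> * r) \<le> \<kappa> * (\<kappa> * s + 2 * \<kappa> * (2 * s))"
        using kappa_pos by (intro mult_left_mono) auto
      then show "\<kappa> * (s + 2 * \<kappa> * r) \<le> vitali_const * s"
        by (simp add: vitali_const_def power2_eq_square algebra_simps)
    qed
    finally show "\<exists>(y, s)\<in>G. B x r \<subseteq> B y (vitali_const * s)" using q ys by blast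
  qed
qed

subsection \<open>Outer regularity\<close>

abbreviation "\<T> \<equiv> quasi_metric_topology (space M) \<rho>"

text \<open>
  Balls need not be open, but the points reachable from the centre by steps of geometrically
  decreasing size form an open set inside the ball.
\<close>

inductive reachable :: "real \<Rightarrow> 'a \<Rightarrow> 'a \<Rightarrow> bool" where
  refl: "0 < r \<Longrightarrow> x \<in> space M \<Longrightarrow> reachable r x x"
| step: "0 < r \<Longrightarrow> x \<in> space M \<Longrightarrow> z \<in> B x (r / (2 * \<kappa>)) \<Longrightarrow> reachable (r / (2 * \<kappa>)) z y \<Longrightarrow>
    reachable r x y"

lemma reachable_in_B: "reachable r x y \<Longrightarrow> y \<in> B x r"
proof (induction rule: reachable.induct)
  case (refl r x)
  then show ?case by (simp add: centre_in_B)
next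
  case (step r x z y)
  \<comment> \<open>The ratio 2\<kappa> is what the quasi-triangle inequality demands:
    \<kappa>(r/(2\<kappa>) + r/(2\<kappa>)) = r.\<close>
  have "B z (r / (2 * \<kappa>)) \<subseteq> B x r"
    using step kappa_pos by (intro B_subset_B[where d = "r / (2 * \<kappa>)"]) (auto simp: field_simps)
  then show ?case using step by blast
qed

lemma reachable_open:
  assumes "reachable r x y"
  shows "\<exists>t>0. B y t \<subseteq> {y. reachable r x y}"
  using assms
proof (induction rule: reachable.induct)
  case (refl r x)
  show ?case
  proof (intro exI[of _ "r / (2 * \<kappa>)"] conjI subsetI CollectI)
    fix y assume "y \<in> B x (r / (2 * \<kappa>))"
    then show "reachable r x y"
      using refl kappa_pos B_subset_space[of x "r / (2 * \<kappa>)"]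
      by (intro reachable.step[of r x y] reachable.refl) auto
  qed (use refl kappa_pos in simp)
next
  case (step r x z y)
  then obtain t where "t > 0" "B y t \<subseteq> {y. reachable (r / (2 * \<kappa>)) z y}" by blast
  moreover have "reachable r x y'" if "reachable (r / (2 * \<kappa>)) z y'" for y'
    by (rule reachable.step[OF step.hyps(1,2,3) that])
  ultimately show ?case by blast
qed

lemma openin_reachable: "openin \<T> {y. reachable r x y}"
  unfolding openin_quasi_metric_topology
  using reachable_open[of r x] reachable_in_B[of r x] B_subset_space[of x r] by blast

lemma openin_in_sets: "openin \<T> U \<Longrightarrow> U \<in> sets M"
  unfolding borel by (rule sigma_sets.Basic) simp

lemma topspace_quasi_metric: "topspace \<T> = space M"
proof -
  have "openin \<T> (space M)"
    unfolding openin_quasi_metric_topology using B_subset_space by (auto intro: exI[of _ 1])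
  then show ?thesis
    using openin_subset[of \<T>] openin_topspace[of \<T>]
    unfolding openin_quasi_metric_topology by blast
qed

lemma openin_subset_space: "openin \<T> U \<Longrightarrow> U \<subseteq> space M"
  using openin_subset[of \<T> U] by (simp add: topspace_quasi_metric)

lemma openin_ball_subset: "openin \<T> U \<Longrightarrow> x \<in> U \<Longrightarrow> \<exists>r>0. B x r \<subseteq> U"
  by (simp add: openin_quasi_metric_topology)

text \<open>The complement of \<open>S\<close> is the intersection of open neighbourhoods
  \<open>W n\<close> at scale 1/(n+1): a point of \<open>S\<close> in all of them would have points
  outside \<open>S\<close> arbitrarily near, against openness. Finite measure of \<open>V\<close>
  turns the empty intersection into small measure.\<close>

lemma open_inner_approximation:
  assumes S: "openin \<T> S" and V: "V \<in> sets M" "emeasure M V < \<infinity>" and e: "0 < (e::ennreal)"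
  shows "\<exists>F. openin \<T> (space M - F) \<and> F \<subseteq> S \<and> emeasure M (V \<inter> (S - F)) < e"
proof -
  define W where "W = (\<lambda>n. \<Union>z\<in>space M - S. {y. reachable (1 / real (Suc n)) z y})"
  \<comment> \<open>Finite intersections are decreasing by construction, so \<open>reachable\<close>
    need not be compared at different scales.\<close>
  define U where "U = (\<lambda>n. \<Inter>i\<in>{..n}. W i)"
  have W_open: "openin \<T> (W n)" for n
    unfolding W_def by (intro openin_Union ballI) (auto simp: openin_reachable)
  then have U_open: "openin \<T> (U n)" for n
    unfolding U_def by (intro openin_Inter) auto
  have WS: "space M - S \<subseteq> W n" for n
    unfolding W_def using reachable.refl[of "1 / real (Suc n)"] by fastforce
  have "S \<inter> (\<Inter>n. U n) = {}"
  proof (rule ccontr)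
    assume "S \<inter> (\<Inter>n. U n) \<noteq> {}"
    then obtain y where y: "y \<in> S" "\<And>n. y \<in> W n" by (auto simp: U_def)
    obtain r where r: "r > 0" "B y r \<subseteq> S"
      using openin_ball_subset[OF S y(1)] by blast
    obtain n where n: "1 / real (Suc n) < r"
      using r(1) nat_approx_posE by metis
    obtain z where z: "z \<in> space M" "z \<notin> S" "reachable (1 / real (Suc n)) z y"
      using y(2)[of n] by (auto simp: W_def)
    have "z \<in> B y (1 / real (Suc n))"
      using reachable_in_B[OF z(3)] z(1) B_sym by blast
    then show False using r z n B_mono[of "1 / real (Suc n)" r y] by auto
  qed
  then have *: "(\<Inter>n. V \<inter> (S \<inter> U n)) = {}" by auto
  have "(\<lambda>n. emeasure M (V \<inter> (S \<inter> U n))) \<longlonglongrightarrow> emeasure M (\<Inter>n. V \<inter> (S \<inter> U n))"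
  proof (rule Lim_emeasure_decseq)
    show "range (\<lambda>n. V \<inter> (S \<inter> U n)) \<subseteq> sets M"
      using V S U_open openin_in_sets by auto
    show "decseq (\<lambda>n. V \<inter> (S \<inter> U n))"
      by (auto simp: decseq_def U_def)
    fix n
    have "emeasure M (V \<inter> (S \<inter> U n)) \<le> emeasure M V"
      using V by (intro emeasure_mono) auto
    then show "emeasure M (V \<inter> (S \<inter> U n)) \<noteq> \<infinity>" using V by (auto simp: top_unique)
  qed
  then have "eventually (\<lambda>n. emeasure M (V \<inter> (S \<inter> U n)) < e) sequentially"
    unfolding * using e by (auto intro: order_tendstoD(2))
  then obtain n where n: "emeasure M (V \<inter> (S \<inter> U n)) < e"
    by (auto simp: eventually_sequentially)
  have US: "U n \<subseteq> space M" "S \<subseteq> space M"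
    using openin_subset_space[OF U_open[of n]] openin_subset_space[OF S] by auto
  show ?thesis
  proof (intro exI[of _ "space M - U n"] conjI)
    show "openin \<T> (space M - (space M - U n))"
      using U_open US by (simp add: double_diff)
    show "space M - U n \<subseteq> S" using WS by (auto simp: U_def)
    have "V \<inter> (S - (space M - U n)) = V \<inter> (S \<inter> U n)" using US by auto
    then show "emeasure M (V \<inter> (S - (space M - U n))) < e" using n by simp
  qed
qed

text \<open>The two-sided form is what passes to complements, where \<open>U\<close> and
  \<open>F\<close> change places. Cutting with \<open>V\<close> supplies the finiteness that
  continuity from above requires.\<close>

lemma borel_approximation:
  assumes V: "V \<in> sets M" "emeasure M V < \<infinity>"
    and S: "S \<in> sets M" and e: "0 < (e::real)"
  shows "\<exists>U F. openin \<T> U \<and> openin \<T> (space M - F) \<and> F \<subseteq> S \<and> S \<subseteq> U \<and>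
    emeasure M (V \<inter> (U - F)) < ennreal e"
proof -
  have "S \<in> sigma_sets (space M) {U. openin \<T> U}" using S borel by simp
  then show ?thesis using e
  proof (induction arbitrary: e rule: sigma_sets.induct)
    case (Basic S)
    then show ?case
      using open_inner_approximation[of S V "ennreal e"] V by fastforce
  next
    case Empty
    have "openin \<T> (space M - {})"
      using openin_topspace[of \<T>] by (simp add: topspace_quasi_metric)
    then show ?case using Empty by (intro exI[of _ "{}"]) auto
  next
    case (Compl S)
    then obtain U F where UF: "openin \<T> U" "openin \<T> (space M - F)" "F \<subseteq> S" "S \<subseteq> U"
      "emeasure M (V \<inter> (U - F)) < ennreal e" by metis
    have Us: "U \<subseteq> space M" using openin_subset_space[OF UF(1)] .
    have "(space M - F) - (space M - U) = U - F" using Us by auto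
    moreover have "space M - (space M - U) = U" using Us by auto
    ultimately show ?case using UF
      by - (rule exI[of _ "space M - F"], rule exI[of _ "space M - U"], auto)
  next
    case (Union S)
    \<comment> \<open>The errors add up to e/2, strictly below \<open>e\<close>; the gap is spent
      when the union of the closed sets is cut down to finitely many.\<close>
    define d where "d = (\<lambda>i::nat. e / 2 * (1/2) ^ Suc i)"
    have "0 < d i" for i using Union by (simp add: d_def)
    then have "\<forall>i. \<exists>U F. openin \<T> U \<and> openin \<T> (space M - F) \<and> F \<subseteq> S i \<and> S i \<subseteq> U \<and>
        emeasure M (V \<inter> (U - F)) < ennreal (d i)"
      using Union.IH by blast
    then obtain U F where U: "\<And>i. openin \<T> (U i)" and F: "\<And>i. openin \<T> (space M - F i)"
      and FS: "\<And>i. F i \<subseteq> S i" and SU: "\<And>i. S i \<subseteq> U i"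
      and le: "\<And>i. emeasure M (V \<inter> (U i - F i)) < ennreal (d i)"
      by metis
    have Fsub: "F i \<subseteq> space M" for i
      using FS[of i] SU[of i] openin_subset_space[OF U[of i]] by blast
    have Fm: "F i \<in> sets M" for i
      using openin_in_sets[OF F[of i]] Fsub[of i] sets.compl_sets[of "space M - F i" M]
      by (simp add: double_diff)
    have Um: "U i \<in> sets M" for i using U openin_in_sets by blast
    have "emeasure M (V \<inter> ((\<Union>i. U i) - (\<Union>i. F i))) \<le> emeasure M (\<Union>i. V \<inter> (U i - F i))"
      using V Um Fm by (intro emeasure_mono) auto
    also have "\<dots> \<le> (\<Sum>i. emeasure M (V \<inter> (U i - F i)))"
      using V Um Fm by (intro emeasure_subadditive_countably) auto
    also have "\<dots> \<le> (\<Sum>i. ennreal (d i))"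
      using le by (intro suminf_le) (auto intro: less_imp_le)
    also have "\<dots> = ennreal (e / 2)"
    proof (rule suminf_ennreal_eq)
      show "0 \<le> d i" for i using Union by (simp add: d_def)
      show "d sums (e / 2)"
        using sums_mult[OF power_half_series, of "e / 2"] by (simp add: d_def)
    qed
    also have "\<dots> < ennreal e" using Union by (simp add: ennreal_lessI)
    finally have small: "emeasure M (V \<inter> ((\<Union>i. U i) - (\<Union>i. F i))) < ennreal e" .
    \<comment> \<open>An infinite union of closed sets may fail to be closed, so only finitely many
      are kept; continuity from above controls what is lost.\<close>
    define K where "K = (\<lambda>n. V \<inter> ((\<Union>i. U i) - (\<Union>i\<le>n. F i)))"
    have K: "(\<Inter>n. K n) = V \<inter> ((\<Union>i. U i) - (\<Union>i. F i))"
      by (auto simp: K_def)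
    have "(\<lambda>n. emeasure M (K n)) \<longlonglongrightarrow> emeasure M (\<Inter>n. K n)"
    proof (rule Lim_emeasure_decseq)
      show "range K \<subseteq> sets M" using V Um Fm by (auto simp: K_def)
      show "decseq K" by (auto simp: decseq_def K_def intro: order.trans)
      fix n
      have "emeasure M (K n) \<le> emeasure M V" using V by (intro emeasure_mono) (auto simp: K_def)
      then show "emeasure M (K n) \<noteq> \<infinity>" using V by (auto simp: top_unique)
    qed
    then have "eventually (\<lambda>n. emeasure M (K n) < ennreal e) sequentially"
      unfolding K using small by (rule order_tendstoD(2))
    then obtain n where n: "emeasure M (K n) < ennreal e" by (auto simp: eventually_sequentially)
    show ?case
    proof (rule exI[of _ "\<Union>i. U i"], rule exI[of _ "\<Union>i\<le>n. F i"], intro conjI)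
      show "openin \<T> (\<Union>i. U i)" using U by blast
      have "openin \<T> (\<Inter>i\<in>{..n}. space M - F i)" using F by (intro openin_Inter) auto
      moreover have "(\<Inter>i\<in>{..n}. space M - F i) = space M - (\<Union>i\<le>n. F i)" by auto
      ultimately show "openin \<T> (space M - (\<Union>i\<le>n. F i))" by simp
      show "emeasure M (V \<inter> ((\<Union>i. U i) - (\<Union>i\<le>n. F i))) < ennreal e" using n by (simp add: K_def)
    qed (use FS SU in blast)+
  qed
qed

lemma outer_regular:
  assumes V: "V \<in> sets M" "emeasure M V < \<infinity>" and S: "S \<in> sets M" and e: "0 < (e::real)"
  obtains U where "openin \<T> U" "S \<subseteq> U" "emeasure M (V \<inter> U) \<le> emeasure M S + ennreal e"
proof -
  obtain U F where UF: "openin \<T> U" "openin \<T> (space M - F)" "F \<subseteq> S" "S \<subseteq> U"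
    "emeasure M (V \<inter> (U - F)) < ennreal e"
    using borel_approximation[OF V S e] by blast
  have "F \<subseteq> space M" using UF S sets.sets_into_space by blast
  then have m: "F \<in> sets M" "U \<in> sets M"
    using openin_in_sets[OF UF(2)] openin_in_sets[OF UF(1)] sets.compl_sets[of "space M - F" M]
    by (simp_all add: double_diff)
  have "emeasure M (V \<inter> U) \<le> emeasure M (S \<union> V \<inter> (U - F))"
    using UF S V m by (intro emeasure_mono) auto
  also have "\<dots> \<le> emeasure M S + emeasure M (V \<inter> (U - F))"
    using S V m by (intro emeasure_subadditive) auto
  also have "\<dots> \<le> emeasure M S + ennreal e"
    using UF by (intro add_left_mono) auto
  finally show ?thesis using that UF by blast
qed

end

section \<open>Weights\<close>

locale weighted_homogeneous_type = homogeneous_type +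
  fixes w :: "'a \<Rightarrow> real"
  assumes weight: "weight M w"
begin

definition \<nu> :: "'a measure" where
  "\<nu> = density M (\<lambda>x. ennreal (w x))"

lemma w_measurable [measurable]: "w \<in> borel_measurable M"
  and w_nonneg: "x \<in> space M \<Longrightarrow> 0 \<le> w x"
  using weight by (auto simp: weight_def)

lemma sets_\<nu> [simp, measurable_cong]: "sets \<nu> = sets M"
  and space_\<nu> [simp]: "space \<nu> = space M"
  by (simp_all add: \<nu>_def)

lemma emeasure_\<nu>: "E \<in> sets M \<Longrightarrow> emeasure \<nu> E = (\<integral>\<^sup>+x\<in>E. ennreal (w x) \<partial>M)"
  unfolding \<nu>_def by (subst emeasure_density) auto

lemma \<nu>_null: "E \<in> sets M \<Longrightarrow> emeasure M E = 0 \<Longrightarrow> emeasure \<nu> E = 0"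
  by (simp add: emeasure_\<nu> nn_integral_null_set null_setsI)

lemma \<nu>_ge:
  assumes "E \<in> sets M" "\<And>x. x \<in> E \<Longrightarrow> a \<le> w x"
  shows "ennreal a * emeasure M E \<le> emeasure \<nu> E"
proof -
  have "ennreal a * emeasure M E = (\<integral>\<^sup>+x. ennreal a * indicator E x \<partial>M)"
    using assms by (simp add: nn_integral_cmult_indicator)
  also have "\<dots> \<le> (\<integral>\<^sup>+x\<in>E. ennreal (w x) \<partial>M)"
    using assms by (intro nn_integral_mono) (auto split: split_indicator intro: ennreal_leI)
  finally show ?thesis using assms by (simp add: emeasure_\<nu>)
qed

lemma \<nu>_le:
  assumes "E \<in> sets M" "\<And>x. x \<in> E \<Longrightarrow> w x \<le> a"
  shows "emeasure \<nu> E \<le> ennreal a * emeasure M E"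
proof -
  have "(\<integral>\<^sup>+x\<in>E. ennreal (w x) \<partial>M) \<le> (\<integral>\<^sup>+x. ennreal a * indicator E x \<partial>M)"
    using assms by (intro nn_integral_mono) (auto split: split_indicator intro: ennreal_leI)
  also have "\<dots> = ennreal a * emeasure M E"
    using assms by (simp add: nn_integral_cmult_indicator)
  finally show ?thesis using assms by (simp add: emeasure_\<nu>)
qed

text \<open>A weak form of Lebesgue's differentiation theorem: no density argument is needed if a
  constant may be lost.\<close>

lemma \<nu>_le_of_small_averages:
  assumes E: "E \<in> sets M" "E \<subseteq> B c R" and c: "c \<in> space M" and R: "0 < R" and \<tau>: "0 \<le> \<tau>"
    and \<delta>: "0 < \<delta>"
    and avg: "\<And>x r. x \<in> E \<Longrightarrow> 0 < r \<Longrightarrow> r < \<delta> \<Longrightarrow> emeasure \<nu> (B x r) \<le> ennreal \<tau> * emeasure M (B x r)"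
  shows "emeasure \<nu> E \<le> ennreal (\<tau> * dilation_const vitali_const) * emeasure M E"
proof -
  define L where "L = vitali_const"
  define D where "D = dilation_const L"
  \<comment> \<open>Large enough to contain every ball of radius at most \<open>R\<close> around a
    point of \<open>E\<close>.\<close>
  define V where "V = B c (\<kappa> * (2 * R))"
  have L: "1 \<le> L" using vitali_const_ge by (simp add: L_def)
  have D: "1 \<le> D" by (simp add: D_def dilation_const_ge_1)
  have V: "V \<in> sets M" "emeasure M V < \<infinity>" using c B_finite[of c] by (auto simp: V_def)
  have Esp: "x \<in> space M" if "x \<in> E" for x using E(2) B_subset_space that by blast
  have approx: "emeasure \<nu> E \<le> ennreal (\<tau> * D) * (emeasure M E + ennreal e)" if "0 < e" for e
  proof -
    obtain U where U: "openin \<T> U" "E \<subseteq> U" "emeasure M (V \<inter> U) \<le> emeasure M E + ennreal e"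
      using outer_regular[OF V E(1) \<open>0 < e\<close>] by blast
    have Um: "U \<in> sets M" using U openin_in_sets by blast
    have "\<exists>r. 0 < r \<and> r \<le> R \<and> L * r < \<delta> \<and> B x r \<subseteq> V \<inter> U" if x: "x \<in> E" for x
    proof -
      obtain r1 where r1: "r1 > 0" "B x r1 \<subseteq> U"
        using openin_ball_subset[OF U(1), of x] U x by blast
      \<comment> \<open>The ball itself stays in \<open>U\<close>, which limits its
        \<open>M\<close>-measure, while its dilate by \<open>L\<close> stays below radius \<delta>,
        where the hypothesis on averages applies.\<close>
      define r where "r = min (min r1 R) (\<delta> / (2 * L))"
      have r: "0 < r" "r \<le> R" "r \<le> r1" "r \<le> \<delta> / (2 * L)" using r1 R L \<delta> by (auto simp: r_def)
      have "L * r \<le> \<delta> / 2" using r(4) L by (simp add: field_simps)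
      then have "L * r < \<delta>" using \<delta> by linarith
      moreover have "B x r \<subseteq> V"
        unfolding V_def using x E c r kappa_pos
        by (intro B_subset_B[where d = R]) (auto intro!: mult_left_mono)
      ultimately show ?thesis using r r1 B_mono[of r r1 x] by blast
    qed
    then obtain rad where rad: "\<And>x. x \<in> E \<Longrightarrow> 0 < rad x \<and> rad x \<le> R \<and> L * rad x < \<delta> \<and> B x (rad x) \<subseteq> V \<inter> U"
      by metis
    define F where "F = (\<lambda>x. (x, rad x)) ` E"
    have F: "x \<in> space M" "0 < r" "r \<le> R" "B x r \<subseteq> V" if "(x, r) \<in> F" for x r
      using that rad Esp by (auto simp: F_def)
    obtain G where G: "G \<subseteq> F" "countable G" "disjoint_family_on (\<lambda>(c, r). B c r) G"
      "\<And>c r. (c, r) \<in> F \<Longrightarrow> \<exists>(y, s)\<in>G. B c r \<subseteq> B y (vitali_const * s)"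
      by (rule vitali_covering[OF F V, of F]) (blast intro: that)+
    have inG: "y \<in> E" "0 < s" "L * s < \<delta>" "B y s \<subseteq> V \<inter> U" if "(y, s) \<in> G" for y s
      using that G(1) rad by (auto simp: F_def)
    have "E \<subseteq> (\<Union>(y, s)\<in>G. B y (L * s))"
    proof
      fix x assume x: "x \<in> E"
      then obtain y s where "(y, s) \<in> G" "B x (rad x) \<subseteq> B y (L * s)"
        using G(4)[of x "rad x"] by (auto simp: L_def F_def)
      moreover have "x \<in> B x (rad x)" using x rad Esp by (intro centre_in_B) auto
      ultimately show "x \<in> (\<Union>(y, s)\<in>G. B y (L * s))" by blast
    qed
    moreover have "(\<Union>(y, s)\<in>G. B y (L * s)) \<in> sets M"
      using G(2) inG(1) Esp by (intro sets.countable_UN') auto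
    ultimately have "emeasure \<nu> E \<le> emeasure \<nu> (\<Union>(y, s)\<in>G. B y (L * s))"
      by (intro emeasure_mono) auto
    also have "\<dots> = emeasure \<nu> (\<Union>p\<in>G. B (fst p) (L * snd p))" by (simp add: case_prod_unfold)
    also have "\<dots> \<le> ennreal (\<tau> * D) * emeasure M (\<Union>p\<in>G. B (fst p) (snd p))"
    proof (rule emeasure_UN_le_disjoint[OF G(2)])
      show "disjoint_family_on (\<lambda>p. B (fst p) (snd p)) G" using G(3) by (simp add: case_prod_unfold)
      fix p assume "p \<in> G"
      then obtain y s where p: "p = (y, s)" "(y, s) \<in> G" by (cases p) auto
      show "B (fst p) (L * snd p) \<in> sets \<nu>" "B (fst p) (snd p) \<in> sets M"
        using inG[OF p(2)] Esp p by auto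
      have "emeasure \<nu> (B y (L * s)) \<le> ennreal \<tau> * emeasure M (B y (L * s))"
        using inG[OF p(2)] L by (intro avg) auto
      also have "\<dots> \<le> ennreal \<tau> * (ennreal D * emeasure M (B y s))"
        unfolding D_def using inG[OF p(2)] Esp by (intro mult_left_mono emeasure_dilation) auto
      finally show "emeasure \<nu> (B (fst p) (L * snd p)) \<le> ennreal (\<tau> * D) * emeasure M (B (fst p) (snd p))"
        using \<tau> D by (simp add: p ennreal_mult mult.assoc)
    qed
    also have "\<dots> \<le> ennreal (\<tau> * D) * emeasure M (V \<inter> U)"
      using inG(4) V Um by (intro mult_left_mono emeasure_mono) force+
    also have "\<dots> \<le> ennreal (\<tau> * D) * (emeasure M E + ennreal e)"
      using U by (intro mult_left_mono) auto
    finally show ?thesis .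
  qed
  have "emeasure \<nu> E \<le> ennreal (\<tau> * D) * emeasure M E + ennreal e" if "0 < e" for e
  proof -
    \<comment> \<open>The summand 1 keeps the denominator positive when \<tau> = 0.\<close>
    have pos: "0 < \<tau> * D + 1" using \<tau> D by (simp add: add_nonneg_pos)
    have "emeasure \<nu> E \<le> ennreal (\<tau> * D) * (emeasure M E + ennreal (e / (\<tau> * D + 1)))"
      using that pos by (intro approx) auto
    also have "\<dots> = ennreal (\<tau> * D) * emeasure M E + ennreal (\<tau> * D * (e / (\<tau> * D + 1)))"
      using \<tau> D that pos by (simp add: distrib_left flip: ennreal_mult)
    also have "\<dots> \<le> ennreal (\<tau> * D) * emeasure M E + ennreal e"
      using that pos by (intro add_left_mono ennreal_leI) (simp add: field_simps)
    finally show ?thesis .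
  qed
  then have "emeasure \<nu> E \<le> ennreal (\<tau> * D) * emeasure M E"
    by (rule ennreal_le_epsilon)
  then show ?thesis
    by (simp only: D_def L_def)
qed

abbreviation "L \<equiv> vitali_const"

lemma level_set_in_sets [measurable]: "E \<in> sets M \<Longrightarrow> {x\<in>E. t < w x} \<in> sets M"
proof -
  assume E: "E \<in> sets M"
  then have "{x\<in>E. t < w x} = E \<inter> {x\<in>space M. t < w x}"
    using sets.sets_into_space by blast
  then show ?thesis using E by simp
qed

lemma maximal_eq:
  assumes V: "V \<in> sets M"
  shows "maximal M \<rho> (\<lambda>y. indicator V y * w y) x =
    (SUP (c, r) \<in> {(c, r). c \<in> space M \<and> 0 < r \<and> x \<in> B c r}. emeasure \<nu> (V \<inter> B c r) / emeasure M (B c r))"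
proof -
  have "(\<integral>\<^sup>+y\<in>B c r. ennreal \<bar>indicator V y * w y\<bar> \<partial>M) = emeasure \<nu> (V \<inter> B c r)" if "c \<in> space M" for c r
    using that V w_nonneg
    by (subst emeasure_\<nu>) (auto intro!: nn_integral_cong split: split_indicator)
  then show ?thesis
    unfolding maximal_def by (intro SUP_cong) auto
qed

lemma maximal_ge:
  assumes V: "V \<in> sets M" and c: "c \<in> space M" "0 < r" and x: "x \<in> B c r" and sub: "B c r \<subseteq> V"
    and avg: "ennreal t * emeasure M (B c r) \<le> emeasure \<nu> (B c r)"
  shows "ennreal t \<le> maximal M \<rho> (\<lambda>y. indicator V y * w y) x"
proof -
  have "ennreal t \<le> emeasure \<nu> (B c r) / emeasure M (B c r)"
    using avg ball_pos[of c r] ball_finite[of c r] c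
    by (simp add: divide_less_ennreal flip: not_less)
  also have "\<dots> = emeasure \<nu> (V \<inter> B c r) / emeasure M (B c r)"
    using sub by (simp add: Int_absorb1)
  also have "\<dots> \<le> maximal M \<rho> (\<lambda>y. indicator V y * w y) x"
    unfolding maximal_eq[OF V] using c x by (intro SUP_upper2[of "(c, r)"]) auto
  finally show ?thesis .
qed

subsection \<open>Stopping balls\<close>

text \<open>Around each point of \<open>S\<close> a nearly maximal radius with average above \<tau>
  is taken, and the covering lemma selects among these balls. A point left uncovered has no such
  radius, so on the remaining set \<open>\<nu>\<close> is at most \<tau> times the dilation constant
  times \<open>M\<close> by weak differentiation, whereas w > t there and t is larger; that set is
  null. The hypothesis on the mass of \<open>V\<close> forces the stopping radii below
  \<open>r1\<close>.\<close>

lemma stopping_balls: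
  assumes V: "V = B c K" "c \<in> space M" "0 < K" and S: "S \<in> sets M"
    and sub: "\<And>x. x \<in> S \<Longrightarrow> B x R \<subseteq> V"
    and \<tau>: "0 < \<tau>" "dilation_const L * \<tau> < t" and t: "\<And>x. x \<in> S \<Longrightarrow> t < w x"
    and r1: "0 < r1" "r1 \<le> R"
    and top: "\<And>x. x \<in> S \<Longrightarrow> emeasure \<nu> V \<le> ennreal \<tau> * emeasure M (B x r1)"
  obtains G where "countable G" "disjoint_family_on (\<lambda>(c, r). B c r) G"
    "\<And>y s. (y, s) \<in> G \<Longrightarrow> y \<in> S" "\<And>y s. (y, s) \<in> G \<Longrightarrow> 0 < s" "\<And>y s. (y, s) \<in> G \<Longrightarrow> s < r1"
    "\<And>y s. (y, s) \<in> G \<Longrightarrow> ennreal \<tau> * emeasure M (B y s) < emeasure \<nu> (B y s)"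
    "\<And>y s r. (y, s) \<in> G \<Longrightarrow> 2 * s \<le> r \<Longrightarrow> r \<le> R \<Longrightarrow>
       emeasure \<nu> (B y r) \<le> ennreal \<tau> * emeasure M (B y r)"
    "emeasure \<nu> (S - (\<Union>(y, s)\<in>G. B y (L * s))) = 0"
proof -
  define P where "P = (\<lambda>x. {r. 0 < r \<and> r \<le> R \<and> ennreal \<tau> * emeasure M (B x r) < emeasure \<nu> (B x r)})"
  have Ssp: "x \<in> space M" if "x \<in> S" for x using S sets.sets_into_space that by blast
  have Vm: "V \<in> sets M" "emeasure M V < \<infinity>" using V B_finite[of c] by auto
  have P_less: "r < r1" if x: "x \<in> S" and r: "r \<in> P x" for x r
  proof (rule ccontr)
    assume "\<not> r < r1"
    then have *: "B x r1 \<subseteq> B x r" by (intro B_mono) auto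
    have "B x r \<subseteq> V" using sub[OF x] B_mono[of r R x] r by (auto simp: P_def)
    then have "emeasure \<nu> (B x r) \<le> emeasure \<nu> V" using Vm by (intro emeasure_mono) auto
    also have "\<dots> \<le> ennreal \<tau> * emeasure M (B x r1)" by (rule top[OF x])
    also have "\<dots> \<le> ennreal \<tau> * emeasure M (B x r)"
      using * Ssp[OF x] by (intro mult_left_mono emeasure_mono) auto
    finally show False using r by (auto simp: P_def)
  qed
  \<comment> \<open>The supremum of the radii need not be attained; a radius above half of it
    suffices, and this is why averages are controlled only from \<open>2 * s\<close> on.\<close>
  have "\<exists>s\<in>P x. \<forall>r\<in>P x. r < 2 * s" if x: "x \<in> S" "P x \<noteq> {}" for x
  proof -
    have bdd: "bdd_above (P x)" by (intro bdd_aboveI[of _ R]) (auto simp: P_def)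
    obtain r where r: "r \<in> P x" using x by blast
    have "0 < Sup (P x)" using cSup_upper[OF r bdd] r by (auto simp: P_def)
    then have "\<exists>s\<in>P x. Sup (P x) / 2 < s" using x bdd by (intro less_cSupD) auto
    then obtain s where s: "s \<in> P x" "Sup (P x) / 2 < s" by blast
    have "r < 2 * s" if "r \<in> P x" for r
      using cSup_upper[OF that bdd] s by linarith
    then show ?thesis using s by blast
  qed
  then obtain rad where rad: "\<And>x. x \<in> S \<Longrightarrow> P x \<noteq> {} \<Longrightarrow> rad x \<in> P x"
    and rad2: "\<And>x r. x \<in> S \<Longrightarrow> r \<in> P x \<Longrightarrow> r < 2 * rad x"
    by (metis empty_iff)
  define F where "F = (\<lambda>x. (x, rad x)) ` {x\<in>S. P x \<noteq> {}}"
  have F: "x \<in> space M" "0 < r" "r \<le> R" "B x r \<subseteq> V" if "(x, r) \<in> F" for x r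
  proof -
    have "x \<in> S" "r \<in> P x" using that rad by (auto simp: F_def)
    then show "x \<in> space M" "0 < r" "r \<le> R" "B x r \<subseteq> V"
      using Ssp sub[of x] B_mono[of r R x] by (auto simp: P_def)
  qed
  obtain G where G: "G \<subseteq> F" "countable G" "disjoint_family_on (\<lambda>(c, r). B c r) G"
    "\<And>c r. (c, r) \<in> F \<Longrightarrow> \<exists>(y, s)\<in>G. B c r \<subseteq> B y (L * s)"
    by (rule vitali_covering[OF F Vm, of F]) (blast intro: that)+
  have inG: "y \<in> S" "s \<in> P y" "s = rad y" if "(y, s) \<in> G" for y s
    using that G(1) rad by (auto simp: F_def)
  show thesis
  proof (rule that[OF G(2,3)])
    fix y s assume ys: "(y, s) \<in> G"
    show "y \<in> S" by (rule inG[OF ys])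
    show "0 < s" "ennreal \<tau> * emeasure M (B y s) < emeasure \<nu> (B y s)"
      using inG[OF ys] by (auto simp: P_def)
    show "s < r1" using P_less inG[OF ys] by blast
    fix r assume r: "2 * s \<le> r" "r \<le> R"
    have "r \<notin> P y" using rad2[of y r] inG[OF ys] r by auto
    then show "emeasure \<nu> (B y r) \<le> ennreal \<tau> * emeasure M (B y r)"
      using r \<open>0 < s\<close> by (auto simp: P_def not_less)
  next
    define U where "U = (\<Union>(y, s)\<in>G. B y (L * s))"
    have Um: "U \<in> sets M"
      unfolding U_def using G(2) inG(1) Ssp by (intro sets.countable_UN') auto
    then have SU: "S - U \<in> sets M" using S by auto
    have SV: "S \<subseteq> V" using sub centre_in_B Ssp r1 by fastforce
    have "emeasure \<nu> (B x r) \<le> ennreal \<tau> * emeasure M (B x r)"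
      if x: "x \<in> S - U" and r: "0 < r" "r < R" for x r
    proof -
      \<comment> \<open>A nonempty \<open>P x\<close> would make \<open>x\<close> the centre of a
        ball in \<open>F\<close>, and the dilates of the selected balls would cover it.\<close>
      have "P x = {}"
      proof (rule ccontr)
        assume ne: "P x \<noteq> {}"
        then have xF: "(x, rad x) \<in> F" using x by (auto simp: F_def)
        then obtain y s where "(y, s) \<in> G" "B x (rad x) \<subseteq> B y (L * s)"
          using G(4)[OF xF] by blast
        moreover have "x \<in> B x (rad x)" using F[OF xF] by (intro centre_in_B)
        ultimately show False using x by (auto simp: U_def)
      qed
      then have "r \<notin> P x" by blast
      then show ?thesis using r by (auto simp: P_def not_less)
    qed
    then have "emeasure \<nu> (S - U) \<le> ennreal (\<tau> * dilation_const L) * emeasure M (S - U)"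
      using SV V r1 \<tau> by (intro \<nu>_le_of_small_averages[OF SU, where c = c and R = K and \<delta> = R]) auto
    moreover have "ennreal t * emeasure M (S - U) \<le> emeasure \<nu> (S - U)"
      using t SU by (intro \<nu>_ge) (auto intro: less_imp_le)
    ultimately have le: "ennreal t * emeasure M (S - U) \<le> ennreal (\<tau> * dilation_const L) * emeasure M (S - U)"
      by simp
    have "emeasure M (S - U) \<le> emeasure M V" using SV Vm by (intro emeasure_mono) auto
    then have fin: "emeasure M (S - U) < top" using Vm by (auto intro: le_less_trans)
    have "emeasure M (S - U) = 0"
    proof (rule ccontr)
      assume "emeasure M (S - U) \<noteq> 0"
      then have "ennreal t \<le> ennreal (\<tau> * dilation_const L)"
        using le fin by (simp add: ennreal_mult_le_mult_iff mult.commute[of _ "emeasure M (S - U)"])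
      then show False using \<tau> dilation_const_ge_1[of L] by (simp add: mult.commute)
    qed
    then show "emeasure \<nu> (S - (\<Union>(y, s)\<in>G. B y (L * s))) = 0"
      using \<nu>_null[OF SU] by (simp add: U_def)
  qed
qed

text \<open>\<open>G\<close> is the union of the stopping balls at level \<tau>. Their averages
  exceed \<tau>, so the maximal function is at least \<tau> on \<open>G\<close>; their dilates by
  \<open>L\<close> have averages at most \<tau> and carry all the mass of the level set, so that
  mass is bounded by the measure of \<open>G\<close>.\<close>

lemma level_set_reverse_weak_type:
  assumes c: "c \<in> space M" and R: "0 < R" and V: "V = B c (2 * \<kappa> * R)"
    and \<tau>: "0 < \<tau>" "dilation_const L * \<tau> < t"
    and top: "ennreal (dilation_const (2 * \<kappa> * L)) * emeasure \<nu> V \<le> ennreal \<tau> * emeasure M (B c R)"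
  obtains G where "G \<in> sets M" "G \<subseteq> V"
    "emeasure \<nu> {x\<in>B c R. t < w x} \<le> ennreal (\<tau> * dilation_const L) * emeasure M G"
    "\<And>x. x \<in> G \<Longrightarrow> ennreal \<tau> \<le> maximal M \<rho> (\<lambda>y. indicator V y * w y) x"
proof -
  define S where "S = {x\<in>B c R. t < w x}"
  define D where "D = dilation_const (2 * \<kappa> * L)"
  have L: "5 \<le> L" by (rule vitali_const_ge)
  have D: "1 \<le> D" by (simp add: D_def dilation_const_ge_1)
  have S: "S \<in> sets M" using c by (simp add: S_def)
  have Ssp: "x \<in> space M" "x \<in> B c R" if "x \<in> S" for x using that B_subset_space by (auto simp: S_def)
  have Vm: "V \<in> sets M" using V c by simp
  have sub: "B x R \<subseteq> V" if "x \<in> S" for x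
    unfolding V using Ssp[OF that] c by (intro B_subset_B[where d = R]) auto
  have top': "emeasure \<nu> V \<le> ennreal \<tau> * emeasure M (B x (R / L))" if x: "x \<in> S" for x
  proof -
    \<comment> \<open>Moving the centre from \<open>c\<close> to \<open>x\<close> costs the factor
      2\<kappa>, and shrinking to radius R/L costs \<open>L\<close>; together they give the constant
      \<open>D\<close>.\<close>
    have "B c R \<subseteq> B x (2 * \<kappa> * R)"
      using Ssp[OF x] c B_sym[of c x R] by (intro B_subset_B[where d = R]) auto
    moreover have "2 * \<kappa> * L * (R / L) = 2 * \<kappa> * R" using L by simp
    ultimately have "emeasure M (B c R) \<le> emeasure M (B x (2 * \<kappa> * L * (R / L)))"
      using Ssp[OF x] by (intro emeasure_mono) auto
    also have "\<dots> \<le> ennreal D * emeasure M (B x (R / L))"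
      unfolding D_def using Ssp[OF x] L R by (intro emeasure_dilation) auto
    finally have "ennreal D * emeasure \<nu> V \<le> ennreal \<tau> * (ennreal D * emeasure M (B x (R / L)))"
      using top unfolding D_def by (meson mult_left_mono order.trans zero_le)
    then have "ennreal D * emeasure \<nu> V \<le> ennreal D * (ennreal \<tau> * emeasure M (B x (R / L)))"
      by (simp add: mult.left_commute)
    then show ?thesis using D by (subst (asm) ennreal_mult_le_mult_iff) auto
  qed
  have K: "0 < 2 * \<kappa> * R" using kappa_pos R by simp
  \<comment> \<open>Stopping radii below R/L keep the dilated balls within radius \<open>R\<close>,
    where the upper bound on averages is available.\<close>
  have r1: "0 < R / L" "R / L \<le> R" using L R by (auto simp: field_simps)
  have t: "t < w x" if "x \<in> S" for x using that by (simp add: S_def)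
  obtain G where G: "countable G" "disjoint_family_on (\<lambda>(c, r). B c r) G"
    "\<And>y s. (y, s) \<in> G \<Longrightarrow> y \<in> S" "\<And>y s. (y, s) \<in> G \<Longrightarrow> 0 < s" "\<And>y s. (y, s) \<in> G \<Longrightarrow> s < R / L"
    "\<And>y s. (y, s) \<in> G \<Longrightarrow> ennreal \<tau> * emeasure M (B y s) < emeasure \<nu> (B y s)"
    "\<And>y s r. (y, s) \<in> G \<Longrightarrow> 2 * s \<le> r \<Longrightarrow> r \<le> R \<Longrightarrow>
       emeasure \<nu> (B y r) \<le> ennreal \<tau> * emeasure M (B y r)"
    "emeasure \<nu> (S - (\<Union>(y, s)\<in>G. B y (L * s))) = 0"
    by (rule stopping_balls[OF V c K S sub \<tau> t r1 top']) blast+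
  define H where "H = (\<Union>(y, s)\<in>G. B y s)"
  define U where "U = (\<Union>(y, s)\<in>G. B y (L * s))"
  have Hm: "H \<in> sets M" unfolding H_def using G(1) G(3) Ssp by (intro sets.countable_UN') auto
  have Um: "U \<in> sets M" unfolding U_def using G(1) G(3) Ssp by (intro sets.countable_UN') auto
  have GV: "B y s \<subseteq> V" if "(y, s) \<in> G" for y s
    using sub[OF G(3)[OF that]] B_mono[of s R y] G(5)[OF that] r1 by auto
  have "emeasure \<nu> S \<le> emeasure \<nu> (U \<union> (S - U))" using Um S by (intro emeasure_mono) auto
  also have "\<dots> \<le> emeasure \<nu> U + emeasure \<nu> (S - U)" using Um S by (intro emeasure_subadditive) auto
  also have "\<dots> = emeasure \<nu> U" using G(8) by (simp add: U_def)
  also have "\<dots> = emeasure \<nu> (\<Union>p\<in>G. B (fst p) (L * snd p))" by (simp add: U_def case_prod_unfold)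
  also have "\<dots> \<le> ennreal (\<tau> * dilation_const L) * emeasure M (\<Union>p\<in>G. B (fst p) (snd p))"
  proof (rule emeasure_UN_le_disjoint[OF G(1)])
    show "disjoint_family_on (\<lambda>p. B (fst p) (snd p)) G" using G(2) by (simp add: case_prod_unfold)
    fix p assume "p \<in> G"
    then obtain y s where p: "p = (y, s)" "(y, s) \<in> G" by (cases p) auto
    note ys = G(3-5)[OF p(2)]
    show "B (fst p) (L * snd p) \<in> sets \<nu>" "B (fst p) (snd p) \<in> sets M"
      using ys Ssp p by auto
    have "emeasure \<nu> (B y (L * s)) \<le> ennreal \<tau> * emeasure M (B y (L * s))"
      using ys L by (intro G(7)[OF p(2)]) (auto simp: field_simps)
    also have "\<dots> \<le> ennreal \<tau> * (ennreal (dilation_const L) * emeasure M (B y s))"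
      using ys Ssp by (intro mult_left_mono emeasure_dilation) auto
    finally show "emeasure \<nu> (B (fst p) (L * snd p)) \<le>
        ennreal (\<tau> * dilation_const L) * emeasure M (B (fst p) (snd p))"
      using \<tau> dilation_const_ge_1[of L] by (simp add: p ennreal_mult mult.assoc)
  qed
  finally have "emeasure \<nu> S \<le> ennreal (\<tau> * dilation_const L) * emeasure M H"
    by (simp add: H_def case_prod_unfold)
  moreover have "ennreal \<tau> \<le> maximal M \<rho> (\<lambda>y. indicator V y * w y) x" if xH: "x \<in> H" for x
  proof -
    obtain y s where ys: "(y, s) \<in> G" "x \<in> B y s" using xH unfolding H_def by blast
    show ?thesis
      using G(3,4,6)[OF ys(1)] GV[OF ys(1)] Ssp ys Vm
      by (intro maximal_ge[of V y s]) (auto intro: less_imp_le)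
  qed
  moreover have "H \<subseteq> V" using GV by (auto simp: H_def)
  ultimately show thesis using that Hm by (simp add: S_def)
qed

text \<open>Up to the last index with \<open>x\<close> in \<open>G k\<close>, the geometric sum is
  at most twice its last term, and that term is at most \<open>m\<close>.\<close>

lemma sum_powers_le:
  fixes m :: ennreal
  assumes "0 \<le> \<tau>" "\<And>k. k < N \<Longrightarrow> x \<in> G k \<Longrightarrow> ennreal (2 ^ k * \<tau>) \<le> m"
  shows "(\<Sum>k<N. ennreal (2 ^ k * \<tau>) * indicator (G k) x) \<le> 2 * m"
  using assms(2)
proof (induction N)
  case (Suc N)
  show ?case
  proof (cases "x \<in> G N")
    case True
    have "(\<Sum>k<Suc N. ennreal (2 ^ k * \<tau>) * indicator (G k) x) \<le> (\<Sum>k<Suc N. ennreal (2 ^ k * \<tau>))"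
      by (intro sum_mono) (auto split: split_indicator)
    also have "\<dots> = ennreal (\<Sum>k<Suc N. 2 ^ k * \<tau>)" using assms(1) by (intro sum_ennreal) auto
    also have "\<dots> \<le> ennreal (2 * (2 ^ N * \<tau>))"
    proof (rule ennreal_leI)
      have "(\<Sum>k<Suc N. 2 ^ k * \<tau>) = (2 ^ Suc N - 1) * \<tau>"
        using sum_gp_strict[of "2::real" "Suc N"] by (simp add: sum_distrib_right[symmetric] del: sum.lessThan_Suc)
      then show "(\<Sum>k<Suc N. 2 ^ k * \<tau>) \<le> 2 * (2 ^ N * \<tau>)" using assms(1) by (simp add: algebra_simps)
    qed
    also have "\<dots> = 2 * ennreal (2 ^ N * \<tau>)" using assms(1) by (simp add: ennreal_mult)
    also have "\<dots> \<le> 2 * m" using Suc.prems[of N] True by (intro mult_left_mono) auto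
    finally show ?thesis .
  qed (use Suc in simp)
qed simp

text \<open>The level set above t_N lies in each of the N lower ones. Each of these has mass at most
  \<open>D1\<close> times its level times the measure of a set where the maximal function reaches
  that level; summed over k, the right-hand sides are at most 2 \<open>D1\<close> times one integral
  of the maximal function. Here \<sigma>1 is fixed before \<epsilon>, because the \<epsilon> used
  later depends on it.\<close>

lemma A_infty_small:
  assumes A: "w \<in> A_infty M \<rho> \<sigma>" and \<sigma>: "1 \<le> \<sigma>"
  obtains \<sigma>1 where "1 \<le> \<sigma>1"
    "\<And>\<epsilon>. 0 < \<epsilon> \<Longrightarrow> \<exists>a>0. \<forall>c\<in>space M. \<forall>r>0. emeasure \<nu> (B c (\<sigma>1 * r)) < top \<longrightarrow>
      emeasure \<nu> {x\<in>B c r. a * (measure \<nu> (B c (\<sigma>1 * r)) / measure M (B c r)) < w x}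
        \<le> ennreal \<epsilon> * emeasure \<nu> (B c (\<sigma>1 * r))"
proof -
  obtain Q0 where Q0: "\<And>c r. c \<in> space M \<Longrightarrow> 0 < r \<Longrightarrow>
      (\<integral>\<^sup>+x\<in>B c r. maximal M \<rho> (\<lambda>y. indicator (B c r) y * w y) x \<partial>M) \<le> ennreal Q0 * emeasure \<nu> (B c (\<sigma> * r))"
    using A unfolding A_infty_def weight_measure_def by (auto simp: emeasure_\<nu>)
  define Q where "Q = max 1 Q0"
  have Q: "(\<integral>\<^sup>+x\<in>B c r. maximal M \<rho> (\<lambda>y. indicator (B c r) y * w y) x \<partial>M) \<le> ennreal Q * emeasure \<nu> (B c (\<sigma> * r))"
    if "c \<in> space M" "0 < r" for c r
    using Q0[OF that] by (rule order.trans) (auto simp: Q_def intro!: mult_right_mono ennreal_leI)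
  have Q1: "1 \<le> Q" by (simp add: Q_def)
  \<comment> \<open>The hypothesis is applied to the ball of radius 2\<kappa>R, which contains the
    stopping balls.\<close>
  define \<sigma>1 where "\<sigma>1 = \<sigma> * (2 * \<kappa>)"
  define D where "D = dilation_const (2 * \<kappa> * L)"
  define D1 where "D1 = dilation_const L"
  have D: "1 \<le> D" "1 \<le> D1" by (simp_all add: D_def D1_def dilation_const_ge_1)
  have k2: "2 * \<kappa> \<le> \<sigma>1" using \<sigma> kappa_ge_1 by (simp add: \<sigma>1_def)
  show thesis
  proof (rule that[of \<sigma>1])
    show "1 \<le> \<sigma>1" using k2 kappa_ge_1 by simp
    fix \<epsilon> :: real assume e: "0 < \<epsilon>"
    obtain N0 :: nat where N0: "2 * D1 * Q / \<epsilon> \<le> N0" using real_arch_simple by blast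
    define N where "N = Suc N0"
    have N: "2 * D1 * Q \<le> \<epsilon> * N" using N0 e by (simp add: N_def field_simps)
    define a where "a = 2 ^ N * (2 * D1 * D)"
    show "\<exists>a>0. \<forall>c\<in>space M. \<forall>r>0. emeasure \<nu> (B c (\<sigma>1 * r)) < top \<longrightarrow>
      emeasure \<nu> {x\<in>B c r. a * (measure \<nu> (B c (\<sigma>1 * r)) / measure M (B c r)) < w x}
        \<le> ennreal \<epsilon> * emeasure \<nu> (B c (\<sigma>1 * r))"
    proof (intro exI[of _ a] conjI ballI allI impI)
      show "0 < a" using D by (simp add: a_def)
      fix c R assume c: "c \<in> space M" and R: "0 < (R::real)" and fin: "emeasure \<nu> (B c (\<sigma>1 * R)) < top"
      define W where "W = measure \<nu> (B c (\<sigma>1 * R))"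
      define m where "m = measure M (B c R)"
      define V where "V = B c (2 * \<kappa> * R)"
      have W: "emeasure \<nu> (B c (\<sigma>1 * R)) = ennreal W"
        unfolding W_def using fin by (intro emeasure_eq_ennreal_measure) auto
      have m: "emeasure M (B c R) = ennreal m"
        unfolding m_def using B_finite[OF c, of R] by (intro emeasure_eq_ennreal_measure) auto
      have m0: "0 < m" using ball_pos[OF c R] by (simp add: m)
      have Vm: "V \<in> sets M" using c by (simp add: V_def)
      have VW: "emeasure \<nu> V \<le> ennreal W"
        unfolding V_def W[symmetric] using k2 R c by (intro emeasure_mono B_mono) auto
      have RV: "B c R \<subseteq> V" unfolding V_def using kappa_ge_1 R by (intro B_mono) auto
      show "emeasure \<nu> {x\<in>B c R. a * (W / m) < w x} \<le> ennreal \<epsilon> * emeasure \<nu> (B c (\<sigma>1 * R))"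
      proof (cases "W = 0")
        case True
        have "emeasure \<nu> {x\<in>B c R. a * (W / m) < w x} \<le> emeasure \<nu> V"
          using RV Vm by (intro emeasure_mono) auto
        then show ?thesis using VW True by simp
      next
        case False
        then have W0: "0 < W" by (simp add: W_def zero_less_measure_iff)
        \<comment> \<open>With \<tau>m = DW, the mass hypothesis of
          \<open>level_set_reverse_weak_type\<close> holds at \<tau> and at all its multiples by
          powers of 2. The further factor 2 in \<open>t\<close> secures the strict inequality that
          the lemma requires.\<close>
        define \<tau> where "\<tau> = D * (W / m)"
        define t where "t = (\<lambda>k::nat. 2 ^ k * (2 * D1 * \<tau>))"
        have \<tau>: "0 < \<tau>" using D W0 m0 by (simp add: \<tau>_def)
        define good where "good = (\<lambda>k G. G \<in> sets M \<and> G \<subseteq> V \<and>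
            emeasure \<nu> {x\<in>B c R. t k < w x} \<le> ennreal (2 ^ k * \<tau> * D1) * emeasure M G \<and>
            (\<forall>x\<in>G. ennreal (2 ^ k * \<tau>) \<le> maximal M \<rho> (\<lambda>y. indicator V y * w y) x))"
        have "\<forall>k. \<exists>G. good k G"
        proof
          fix k
          have "ennreal D * emeasure \<nu> V \<le> ennreal D * ennreal W"
            using VW by (intro mult_left_mono) auto
          also have "\<dots> = ennreal (\<tau> * m)" using D W0 m0 by (simp add: \<tau>_def ennreal_mult)
          also have "\<dots> \<le> ennreal (2 ^ k * \<tau> * m)"
            using \<tau> m0 by (intro ennreal_leI mult_right_mono) auto
          also have "\<dots> = ennreal (2 ^ k * \<tau>) * emeasure M (B c R)"
            unfolding m using \<tau> m0 by (intro ennreal_mult) auto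
          finally have top: "ennreal D * emeasure \<nu> V \<le> ennreal (2 ^ k * \<tau>) * emeasure M (B c R)" .
          have "0 < 2 ^ k * \<tau>" "dilation_const L * (2 ^ k * \<tau>) < t k"
            using \<tau> D by (auto simp: t_def D1_def)
          then show "\<exists>G. good k G"
            unfolding good_def D1_def
            by (rule level_set_reverse_weak_type[OF c R V_def _ _ top[unfolded D_def]]) blast
        qed
        then obtain G where good: "\<And>k. good k (G k)" by metis
        have Gm: "G k \<in> sets M" and GV: "G k \<subseteq> V"
          and G: "emeasure \<nu> {x\<in>B c R. t k < w x} \<le> ennreal (2 ^ k * \<tau> * D1) * emeasure M (G k)" for k
          using good[of k] by (simp_all add: good_def)
        have Gmax: "ennreal (2 ^ k * \<tau>) \<le> maximal M \<rho> (\<lambda>y. indicator V y * w y) x" if "x \<in> G k" for k x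
          using good[of k] that by (simp add: good_def)
        define h where "h = (\<lambda>x. \<Sum>k<N. ennreal (2 ^ k * \<tau>) * indicator (G k) x)"
        have h: "h \<in> borel_measurable M" unfolding h_def using Gm by measurable
        have half: "2 * (1 / 2) = (1::ennreal)" by (simp add: ennreal_times_divide)
        then have half': "(1 / 2) * (2 * z) = z" for z :: ennreal
          by (metis mult.assoc mult.commute mult.right_neutral)
        have "of_nat N * emeasure \<nu> {x\<in>B c R. t N < w x} = (\<Sum>k<N. emeasure \<nu> {x\<in>B c R. t N < w x})"
          by simp
        also have "\<dots> \<le> (\<Sum>k<N. emeasure \<nu> {x\<in>B c R. t k < w x})"
        proof (intro sum_mono emeasure_mono subsetI)
          fix k x assume k: "k \<in> {..<N}" and x: "x \<in> {x\<in>B c R. t N < w x}"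
          have "t k \<le> t N" unfolding t_def using k \<tau> D by (intro mult_right_mono power_increasing) auto
          then show "x \<in> {x\<in>B c R. t k < w x}" using x by auto
        qed (use c in auto)
        also have "\<dots> \<le> (\<Sum>k<N. ennreal D1 * (ennreal (2 ^ k * \<tau>) * emeasure M (G k)))"
          using G \<tau> D by (intro sum_mono) (simp add: ennreal_mult mult_ac)
        also have "\<dots> = ennreal D1 * (\<Sum>k<N. \<integral>\<^sup>+x. ennreal (2 ^ k * \<tau>) * indicator (G k) x \<partial>M)"
          using Gm by (simp add: sum_distrib_left nn_integral_cmult_indicator)
        also have "\<dots> = ennreal D1 * (\<integral>\<^sup>+x. h x \<partial>M)"
          unfolding h_def using Gm by (subst nn_integral_sum) auto
        \<comment> \<open>The factor is moved through the integral on the side of \<open>h\<close>,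
          which is measurable, before passing to the maximal function, which need not be.\<close>
        also have "\<dots> = ennreal D1 * (2 * (\<integral>\<^sup>+x. (1 / 2) * h x \<partial>M))"
          using h half by (simp add: nn_integral_cmult flip: mult.assoc)
        also have "\<dots> \<le> ennreal D1 * (2 * (\<integral>\<^sup>+x\<in>V. maximal M \<rho> (\<lambda>y. indicator V y * w y) x \<partial>M))"
        proof (intro mult_left_mono nn_integral_mono)
          fix x
          have "h x \<le> 2 * (maximal M \<rho> (\<lambda>y. indicator V y * w y) x * indicator V x)"
            unfolding h_def using \<tau> Gmax GV by (intro sum_powers_le) (auto split: split_indicator)
          then have "(1 / 2) * h x \<le>
              (1 / 2) * (2 * (maximal M \<rho> (\<lambda>y. indicator V y * w y) x * indicator V x))"
            by (intro mult_left_mono) auto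
          then show "(1 / 2) * h x \<le> maximal M \<rho> (\<lambda>y. indicator V y * w y) x * indicator V x"
            by (simp only: half')
        qed auto
        also have "\<dots> \<le> ennreal D1 * (2 * (ennreal Q * ennreal W))"
          using Q[OF c, of "2 * \<kappa> * R"] R kappa_pos
          by (intro mult_left_mono) (auto simp: V_def W[symmetric] \<sigma>1_def mult_ac)
        also have "\<dots> = ennreal (2 * D1 * Q * W)"
          using D Q1 W0 by (simp add: ennreal_mult mult_ac)
        also have "\<dots> \<le> ennreal (\<epsilon> * N * W)"
          using N W0 by (intro ennreal_leI mult_right_mono) auto
        also have "\<dots> = of_nat N * (ennreal \<epsilon> * ennreal W)"
          using e W0 by (simp add: ennreal_mult mult_ac ennreal_of_nat_eq_real_of_nat)
        finally have "emeasure \<nu> {x\<in>B c R. t N < w x} \<le> ennreal \<epsilon> * ennreal W"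
          by (subst (asm) ennreal_mult_le_mult_iff) (auto simp: N_def)
        moreover have "t N = a * (W / m)" by (simp add: t_def a_def \<tau>_def)
        ultimately show ?thesis by (simp add: W)
      qed
    qed
  qed
qed

text \<open>The part of \<open>Y\<close> where w \<le> t carries at most \<open>t * m\<close>, which
  is half of the assumed mass.\<close>

lemma half_mass_above_level:
  assumes Y: "Y \<in> sets M" "emeasure M Y \<le> m" and m: "m < top" and t: "0 \<le> t"
    and le: "ennreal (2 * t) * m \<le> emeasure \<nu> Y"
  shows "ennreal t * m \<le> emeasure \<nu> {x\<in>Y. t < w x}"
proof -
  have *: "Y - {x\<in>Y. t < w x} \<in> sets M" using Y by auto
  have "emeasure \<nu> Y = emeasure \<nu> ({x\<in>Y. t < w x} \<union> (Y - {x\<in>Y. t < w x}))"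
    by (rule arg_cong[where f = "emeasure \<nu>"]) auto
  also have "\<dots> \<le> emeasure \<nu> {x\<in>Y. t < w x} + emeasure \<nu> (Y - {x\<in>Y. t < w x})"
    using Y * by (intro emeasure_subadditive) auto
  also have "\<dots> \<le> emeasure \<nu> {x\<in>Y. t < w x} + ennreal t * emeasure M (Y - {x\<in>Y. t < w x})"
    using * by (intro add_left_mono \<nu>_le) auto
  also have "\<dots> \<le> emeasure \<nu> {x\<in>Y. t < w x} + ennreal t * emeasure M Y"
    using Y by (intro add_left_mono mult_left_mono emeasure_mono) auto
  also have "\<dots> \<le> emeasure \<nu> {x\<in>Y. t < w x} + ennreal t * m"
    using Y by (intro add_left_mono mult_left_mono) auto
  finally have "ennreal (2 * t) * m \<le> emeasure \<nu> {x\<in>Y. t < w x} + ennreal t * m"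
    using le by (rule order.trans[rotated])
  moreover have "ennreal (2 * t) * m = ennreal t * m + ennreal t * m"
    using t by (simp only: mult_2 ennreal_plus distrib_right)
  ultimately have "ennreal t * m + ennreal t * m \<le> ennreal t * m + emeasure \<nu> {x\<in>Y. t < w x}"
    by (simp add: add.commute)
  moreover have "ennreal t * m \<noteq> top" using m by (simp add: ennreal_mult_eq_top_iff)
  ultimately show ?thesis by (simp add: ennreal_add_left_cancel_le)
qed

subsection \<open>Decay of the level sets\<close>

text \<open>Thresholds are real numbers, hence the restriction to finite mass; where the enlarged
  ball has infinite mass, each of the three conditions is trivial once its constant is
  positive.\<close>

definition level_decay :: bool where
  "level_decay \<longleftrightarrow> (\<exists>\<sigma>\<ge>1. \<exists>C>0. \<exists>b>1. \<forall>c\<in>space M. \<forall>r>0. emeasure \<nu> (B c (\<sigma> * r)) < top \<longrightarrow>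
     (\<forall>k. emeasure \<nu> {x\<in>B c r. C * b ^ k * (measure \<nu> (B c (\<sigma> * r)) / measure M (B c r)) < w x}
       \<le> ennreal ((1/2) ^ k) * emeasure \<nu> (B c (\<sigma> * r))))"

text \<open>
  Passing from one level to the next halves the mass, at the price of moving to the stopping balls.
  Their radii decay geometrically with the level, so even with the quasi-triangle inequality the
  chain of stopping balls stays near the initial ball.
\<close>

lemma small_imp_level_decay:
  assumes \<sigma>1: "1 \<le> \<sigma>1" and a: "0 < a"
    and small: "\<And>c r. c \<in> space M \<Longrightarrow> 0 < r \<Longrightarrow> emeasure \<nu> (B c (\<sigma>1 * r)) < top \<Longrightarrow>
      emeasure \<nu> {x\<in>B c r. a * (measure \<nu> (B c (\<sigma>1 * r)) / measure M (B c r)) < w x}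
        \<le> ennreal (1 / (4 * dilation_const (\<sigma>1 * L))) * emeasure \<nu> (B c (\<sigma>1 * r))"
  shows level_decay
proof -
  \<comment> \<open>A stopping radius u < \<theta>s then has \<sigma>1 L u < s/(2\<kappa>): the
    enlarged ball stays within the range where averages are controlled, and \<kappa>u \<le> s/2
    bounds the drift.\<close>
  define \<theta> where "\<theta> = 1 / (2 * \<kappa> * \<sigma>1 * L)"
  define C1 where "C1 = dilation_const L"
  define D1 where "D1 = dilation_const \<sigma>1"
  define D2 where "D2 = dilation_const (\<sigma>1 * L)"
  define D3 where "D3 = dilation_const (3 * \<kappa>\<^sup>2 / \<theta>)"
  define D4 where "D4 = dilation_const (4 * \<kappa>)"
  \<comment> \<open>A sum dominating three requirements at once: \<open>2 * C1\<close> separates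
    consecutive levels for \<open>stopping_balls\<close>, \<open>D4\<close> pays for shrinking the
    radius by 4\<kappa> at each level, and \<open>2 * a * D1\<close> makes the next level exceed the
    threshold in \<open>small\<close>. The 1 gives strictness.\<close>
  define b where "b = 2 * C1 + 1 + D4 + 2 * a * D1"
  have D: "1 \<le> C1" "1 \<le> D1" "1 \<le> D2" "1 \<le> D3" "1 \<le> D4"
    by (simp_all add: C1_def D1_def D2_def D3_def D4_def dilation_const_ge_1)
  have L: "5 \<le> L" by (rule vitali_const_ge)
  have \<theta>: "0 < \<theta>" using kappa_pos \<sigma>1 L by (simp add: \<theta>_def)
  have "0 < a * D1" using a D by simp
  then have b: "2 * C1 < b" "D4 \<le> b" "2 * a * D1 \<le> b" "1 < b"
    using D unfolding b_def by linarith+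
  have kk: "\<kappa> \<le> \<kappa>\<^sup>2" "1 \<le> \<kappa>\<^sup>2" using kappa_ge_1 by (auto intro: one_le_power self_le_power)
  have mult3: "ennreal p * (ennreal q * (ennreal r * A)) = ennreal (p * q * r) * A"
    if "0 \<le> p" "0 \<le> q" "0 \<le> r" for p q r A
    using that by (simp add: ennreal_mult mult.assoc)
  have main: "emeasure \<nu> {x\<in>B c R. D3 * b ^ k * (measure \<nu> (B c (3 * \<kappa>\<^sup>2 * R)) / measure M (B c R)) < w x}
       \<le> ennreal ((1/2) ^ k) * emeasure \<nu> (B c (3 * \<kappa>\<^sup>2 * R))"
    if c: "c \<in> space M" and R: "0 < R" and fin: "emeasure \<nu> (B c (3 * \<kappa>\<^sup>2 * R)) < top" for c R k
  proof -
    \<comment> \<open>Every point of the iteration lies within 2\<kappa>R of \<open>c\<close>, and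
      \<kappa>(2\<kappa>R + R) \<le> 3\<kappa>^2 R, so its ball of radius \<open>R\<close> stays in
      \<open>V\<close>.\<close>
    define V where "V = B c (3 * \<kappa>\<^sup>2 * R)"
    define W where "W = measure \<nu> V"
    define m where "m = measure M (B c R)"
    have W: "emeasure \<nu> V = ennreal W"
      unfolding W_def V_def using fin by (intro emeasure_eq_ennreal_measure) auto
    have m0: "0 < m" unfolding m_def using c R by (rule measure_B_pos)
    have Vm: "V \<in> sets M" using c by (simp add: V_def)
    have RV: "B c R \<subseteq> V"
      unfolding V_def using kk R by (intro B_mono) (simp add: mult_le_cancel_right1)
    define lev where "lev = (\<lambda>k::nat. D3 * b ^ k * (W / m))"
    \<comment> \<open>The distance from \<open>B c R\<close> permitted at level \<open>k\<close>.
      The induction descends in \<open>k\<close>, so a set may move outwards at each step; the ratio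
      4\<kappa> leaves room for both the old distance and the new stopping radius.\<close>
    define s where "s = (\<lambda>k::nat. R / (4 * \<kappa>) ^ k)"
    have s0: "0 < s k" for k using R kappa_pos by (simp add: s_def)
    have sR: "s k \<le> R" for k
    proof -
      have "1 \<le> (4 * \<kappa>) ^ k" using kappa_ge_1 by (intro one_le_power) simp
      then have "R * 1 \<le> R * (4 * \<kappa>) ^ k" using R by (intro mult_left_mono) auto
      then show ?thesis using kappa_pos by (simp add: s_def divide_le_eq)
    qed
    have sS: "\<kappa> * s (Suc k) = s k / 4" for k using kappa_pos by (simp add: s_def)
    show ?thesis
    proof (cases "W = 0")
      case True
      have "emeasure \<nu> {x\<in>B c R. lev k < w x} \<le> emeasure \<nu> V"
        using RV Vm by (intro emeasure_mono) auto
      then show ?thesis using True W by (simp add: V_def[symmetric] W_def[symmetric] m_def[symmetric] lev_def)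
    next
      case False
      then have W0: "0 < W" by (simp add: W_def zero_less_measure_iff)
      have lev0: "0 < lev k" for k using D b m0 W0 by (simp add: lev_def)
      have levS: "lev (Suc k) = b * lev k" for k by (simp add: lev_def)
      \<comment> \<open>Generalised from level sets in \<open>B c R\<close> to arbitrary sets above
        the level and near \<open>B c R\<close>, since the induction step replaces \<open>E\<close>
        by a subset of stopping balls that may leave \<open>B c R\<close>.\<close>
      have "emeasure \<nu> E \<le> ennreal ((1/2) ^ k * W)"
        if "E \<in> sets M" "\<And>x. x \<in> E \<Longrightarrow> lev k < w x" "\<And>x. x \<in> E \<Longrightarrow> \<exists>z\<in>B c R. x \<in> B z (s k)" for E k
        using that
      proof (induction k arbitrary: E)
        case 0
        have "E \<subseteq> V"
        proof
          fix x assume "x \<in> E"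
          then obtain z where z: "z \<in> B c R" "x \<in> B z R" using 0 by (auto simp: s_def)
          have "B z R \<subseteq> V" unfolding V_def
          proof (rule B_subset_B[OF c z(1)])
            have "2 * \<kappa> * R \<le> 3 * \<kappa>\<^sup>2 * R" using kk R by (intro mult_right_mono) auto
            then show "\<kappa> * (R + R) \<le> 3 * \<kappa>\<^sup>2 * R" by simp
          qed
          then show "x \<in> V" using z by blast
        qed
        then show ?case using emeasure_mono[of E V \<nu>] Vm W by simp
      next
        case (Suc k)
        have Esp: "x \<in> space M" if "x \<in> E" for x using Suc(2) sets.sets_into_space that by blast
        have near: "x \<in> B c (2 * \<kappa> * R)" if xE: "x \<in> E" for x
        proof -
          obtain z where z: "z \<in> B c R" "x \<in> B z (s (Suc k))" using Suc(4)[OF xE] by blast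
          have "x \<in> B z R" using z sR[of "Suc k"] B_mono[of "s (Suc k)" R z] by blast
          moreover have "B z R \<subseteq> B c (2 * \<kappa> * R)" using c z by (intro B_subset_B[where d = R]) auto
          ultimately show ?thesis by blast
        qed
        have k3: "\<kappa> * (2 * \<kappa> * R + R) \<le> 3 * \<kappa>\<^sup>2 * R"
        proof -
          have "\<kappa> * R \<le> \<kappa>\<^sup>2 * R" using kk R by (intro mult_right_mono) auto
          then show ?thesis by (simp add: power2_eq_square algebra_simps)
        qed
        have sub: "B x R \<subseteq> V" if "x \<in> E" for x
          unfolding V_def using near[OF that] c k3 by (intro B_subset_B)
        have sub': "B c R \<subseteq> B x (3 * \<kappa>\<^sup>2 * R)" if "x \<in> E" for x
          using near[OF that] c k3 B_sym[of c x] Esp[OF that] by (intro B_subset_B) auto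
        \<comment> \<open>\<open>D3\<close> compares the scale of \<open>V\<close> with \<theta>R,
          and \<open>D4 ^ k\<close> compares \<theta>R with \<theta>s_k. Since \<open>D4\<close> is
          at most \<open>b\<close>, the growth of the levels compensates for the shrinking
          balls.\<close>
        have top: "emeasure \<nu> V \<le> ennreal (2 * lev k) * emeasure M (B x (\<theta> * s k))" if x: "x \<in> E" for x
        proof -
          define \<mu> where "\<mu> = measure M (B x (\<theta> * s k))"
          have "m \<le> measure M (B x (3 * \<kappa>\<^sup>2 * R))"
            unfolding m_def using sub'[OF x] c Esp[OF x] by (intro measure_B_mono)
          also have "3 * \<kappa>\<^sup>2 * R = 3 * \<kappa>\<^sup>2 / \<theta> * (\<theta> * R)" using \<theta> by simp
          also have "measure M (B x \<dots>) \<le> D3 * measure M (B x (\<theta> * R))"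
            unfolding D3_def using Esp[OF x] \<theta> R by (intro measure_dilation) auto
          also have "\<theta> * R = (4 * \<kappa>) ^ k * (\<theta> * s k)" using kappa_pos by (simp add: s_def)
          also have "measure M (B x \<dots>) \<le> D4 ^ k * \<mu>"
            unfolding D4_def \<mu>_def using Esp[OF x] \<theta> s0 kappa_pos by (intro measure_dilation_power) auto
          also have "\<dots> \<le> b ^ k * \<mu>"
            using b D by (intro mult_right_mono power_mono) (auto simp: \<mu>_def)
          finally have "m \<le> D3 * (b ^ k * \<mu>)" using D by (simp add: mult_left_mono)
          then have "W / m * m \<le> W / m * (D3 * (b ^ k * \<mu>))"
            using W0 m0 by (intro mult_left_mono) auto
          then have "W \<le> lev k * \<mu>" using m0 by (simp add: lev_def mult_ac)
          also have "\<dots> \<le> 2 * lev k * \<mu>" using lev0[of k] by (intro mult_right_mono) (auto simp: \<mu>_def)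
          finally have "ennreal W \<le> ennreal (2 * lev k * \<mu>)" by (rule ennreal_leI)
          also have "\<dots> = ennreal (2 * lev k) * emeasure M (B x (\<theta> * s k))"
            unfolding emeasure_B[OF Esp[OF x]] \<mu>_def[symmetric] using lev0[of k]
            by (intro ennreal_mult) (auto simp: \<mu>_def)
          finally show ?thesis using W by simp
        qed
        have \<tau>: "0 < 2 * lev k" "dilation_const L * (2 * lev k) < lev (Suc k)"
          using lev0[of k] b(1) by (auto simp: levS C1_def)
        have K: "0 < 3 * \<kappa>\<^sup>2 * R" using kappa_pos R by simp
        have \<theta>1: "\<sigma>1 * L * \<theta> = 1 / (2 * \<kappa>)" using \<sigma>1 L by (simp add: \<theta>_def)
        have "\<theta> \<le> \<sigma>1 * L * \<theta>" using \<theta> mult_mono[of 1 \<sigma>1 1 L] \<sigma>1 L by simp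
        then have "\<theta> \<le> 1 / (2 * \<kappa>)" using \<theta>1 by simp
        also have "\<dots> \<le> 1" using kappa_ge_1 by simp
        finally have "\<theta> * s k \<le> 1 * s k" using s0[of k] by (intro mult_right_mono) auto
        then have r1: "0 < \<theta> * s k" "\<theta> * s k \<le> R" using \<theta> s0[of k] sR[of k] by (simp, linarith)
        obtain G where G: "countable G" "disjoint_family_on (\<lambda>(c, r). B c r) G"
          "\<And>y u. (y, u) \<in> G \<Longrightarrow> y \<in> E" "\<And>y u. (y, u) \<in> G \<Longrightarrow> 0 < u" "\<And>y u. (y, u) \<in> G \<Longrightarrow> u < \<theta> * s k"
          "\<And>y u. (y, u) \<in> G \<Longrightarrow> ennreal (2 * lev k) * emeasure M (B y u) < emeasure \<nu> (B y u)"
          "\<And>y u r. (y, u) \<in> G \<Longrightarrow> 2 * u \<le> r \<Longrightarrow> r \<le> R \<Longrightarrow>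
             emeasure \<nu> (B y r) \<le> ennreal (2 * lev k) * emeasure M (B y r)"
          "emeasure \<nu> (E - (\<Union>(y, u)\<in>G. B y (L * u))) = 0"
          by (rule stopping_balls[OF V_def c K Suc(2) sub \<tau> Suc(3) r1 top]) blast+
        define U where "U = (\<Union>(y, u)\<in>G. B y (L * u))"
        have Um: "U \<in> sets M" unfolding U_def using G(1) G(3) Esp by (intro sets.countable_UN') auto
        \<comment> \<open>\<open>Y\<close> splits the covered part of \<open>E\<close> at level k+1
          among the dilated stopping balls; \<open>Z\<close> is the mass at level \<open>k\<close>
          in the undilated disjoint balls that absorbs it.\<close>
        define Y where "Y = (\<lambda>p::'a \<times> real. E \<inter> B (fst p) (L * snd p))"
        define Z where "Z = (\<lambda>p::'a \<times> real. {x\<in>B (fst p) (snd p). lev k < w x})"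
        have Zm: "(\<Union>p\<in>G. Z p) \<in> sets M"
          using G(1) G(3) Esp by (intro sets.countable_UN') (auto simp: Z_def)
        have "emeasure \<nu> E = emeasure \<nu> (E \<inter> U \<union> (E - U))"
          by (rule arg_cong[where f = "emeasure \<nu>"]) auto
        also have "\<dots> \<le> emeasure \<nu> (E \<inter> U) + emeasure \<nu> (E - U)"
          using Um Suc(2) by (intro emeasure_subadditive) auto
        also have "\<dots> = emeasure \<nu> (E \<inter> U)" using G(8) by (simp add: U_def)
        also have "E \<inter> U = (\<Union>p\<in>G. Y p)" by (auto simp: U_def Y_def)
        also have "emeasure \<nu> \<dots> \<le> ennreal (1/2) * emeasure \<nu> (\<Union>p\<in>G. Z p)"
        proof (rule emeasure_UN_le_disjoint[OF G(1)])
          show "disjoint_family_on Z G"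
            using G(2) unfolding Z_def disjoint_family_on_def case_prod_unfold by blast
          fix p assume "p \<in> G"
          then obtain y u where p: "p = (y, u)" "(y, u) \<in> G" by (cases p) auto
          note yu = G(3-5)[OF p(2)]
          have y: "y \<in> space M" using Esp yu by blast
          show "Y p \<in> sets \<nu>" "Z p \<in> sets \<nu>" using y p Suc(2) by (auto simp: Y_def Z_def)
          have "\<theta> * s k \<le> \<theta> * R" using sR[of k] \<theta> by (intro mult_left_mono) auto
          then have "\<sigma>1 * L * u \<le> \<sigma>1 * L * (\<theta> * R)"
            using yu \<sigma>1 L by (intro mult_left_mono) auto
          also have "\<dots> = R / (2 * \<kappa>)" using \<theta>1 by (simp add: mult.assoc[symmetric])
          also have "\<dots> \<le> R" using R kappa_ge_1 by (simp add: divide_le_eq)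
          finally have uR: "\<sigma>1 * (L * u) \<le> R" by (simp add: mult.assoc)
          have "1 * L * u \<le> \<sigma>1 * L * u" using \<sigma>1 L yu by (intro mult_right_mono) auto
          moreover have "2 * u \<le> L * u" using L yu by (intro mult_right_mono) auto
          ultimately have u2: "2 * u \<le> \<sigma>1 * (L * u)" by (simp add: mult.assoc)
          have Lu: "0 < L * u" using L yu by simp
          \<comment> \<open>The substitute for doubling of \<open>\<nu>\<close>: the enlarged radius
            lies between twice the stopping radius and \<open>R\<close>.\<close>
          have avg: "emeasure \<nu> (B y (\<sigma>1 * (L * u))) \<le> ennreal (2 * lev k) * emeasure M (B y (\<sigma>1 * (L * u)))"
            by (rule G(7)[OF p(2) u2 uR])
          then have fin: "emeasure \<nu> (B y (\<sigma>1 * (L * u))) < top"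
            using B_finite[OF y] by (auto simp: ennreal_mult_less_top intro: le_less_trans)
          have "measure \<nu> (B y (\<sigma>1 * (L * u))) \<le> 2 * lev k * measure M (B y (\<sigma>1 * (L * u)))"
            using avg fin lev0[of k] unfolding emeasure_B[OF y]
            by (subst (asm) emeasure_eq_ennreal_measure) (auto simp flip: ennreal_mult)
          also have "\<dots> \<le> 2 * lev k * (D1 * measure M (B y (L * u)))"
            unfolding D1_def using lev0[of k] y Lu by (intro mult_left_mono measure_dilation) auto
          finally have "a * (measure \<nu> (B y (\<sigma>1 * (L * u))) / measure M (B y (L * u))) \<le> a * (2 * lev k * D1)"
            using a measure_B_pos[OF y Lu] by (intro mult_left_mono) (auto simp: divide_le_eq mult_ac)
          also have "\<dots> \<le> lev (Suc k)" using b(3) lev0[of k] by (simp add: levS mult_right_mono mult_ac)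
          finally have thr: "a * (measure \<nu> (B y (\<sigma>1 * (L * u))) / measure M (B y (L * u))) \<le> lev (Suc k)" .
          have "emeasure \<nu> (Y p) \<le>
              emeasure \<nu> {x\<in>B y (L * u). a * (measure \<nu> (B y (\<sigma>1 * (L * u))) / measure M (B y (L * u))) < w x}"
            using thr Suc(3) y by (intro emeasure_mono) (auto simp: Y_def p intro: le_less_trans)
          also have "\<dots> \<le> ennreal (1 / (4 * D2)) * emeasure \<nu> (B y (\<sigma>1 * (L * u)))"
            unfolding D2_def using y Lu fin by (rule small)
          also have "\<dots> \<le> ennreal (1 / (4 * D2)) * (ennreal (2 * lev k) * emeasure M (B y (\<sigma>1 * L * u)))"
            using avg by (intro mult_left_mono) (auto simp: mult.assoc)
          also have "\<dots> \<le> ennreal (1 / (4 * D2)) * (ennreal (2 * lev k) * (ennreal D2 * emeasure M (B y u)))"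
            unfolding D2_def using y yu by (intro mult_left_mono emeasure_dilation) auto
          also have "\<dots> = ennreal (1 / (4 * D2) * (2 * lev k) * D2) * emeasure M (B y u)"
            using D lev0[of k] by (intro mult3) auto
          \<comment> \<open>This fixes the smallness 1/(4 \<open>D2\<close>): \<open>D2\<close> pays
            for the dilation by \<sigma>1 L, one factor 2 for stopping at \<open>2 * lev k\<close>,
            and the other is the gain per level.\<close>
          also have "1 / (4 * D2) * (2 * lev k) * D2 = 1/2 * lev k" using D by simp
          also have "ennreal (1/2 * lev k) * emeasure M (B y u) = ennreal (1/2) * (ennreal (lev k) * emeasure M (B y u))"
            using lev0[of k] by (subst ennreal_mult) (auto simp: mult.assoc)
          also have "\<dots> \<le> ennreal (1/2) * emeasure \<nu> (Z p)"
            unfolding Z_def p fst_conv snd_conv using y B_finite[OF y] lev0[of k] G(6)[OF p(2)]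
            by (intro mult_left_mono half_mass_above_level) (auto intro: less_imp_le)
          finally show "emeasure \<nu> (Y p) \<le> ennreal (1/2) * emeasure \<nu> (Z p)" .
        qed
        also have "\<dots> \<le> ennreal (1/2) * ennreal ((1/2) ^ k * W)"
        proof (intro mult_left_mono Suc.IH[OF Zm])
          show "lev k < w x" if "x \<in> (\<Union>p\<in>G. Z p)" for x using that by (auto simp: Z_def)
          fix x assume "x \<in> (\<Union>p\<in>G. Z p)"
          then obtain y u where yu: "(y, u) \<in> G" "x \<in> B y u" by (auto simp: Z_def)
          obtain z where z: "z \<in> B c R" "y \<in> B z (s (Suc k))" using Suc(4) G(3)[OF yu(1)] by blast
          have "\<theta> \<le> 1 / (2 * \<kappa>)" by fact
          then have "\<theta> * s k \<le> 1 / (2 * \<kappa>) * s k" using s0[of k] by (intro mult_right_mono) auto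
          then have "u \<le> s k / (2 * \<kappa>)" using G(5)[OF yu(1)] by simp
          then have "\<kappa> * u \<le> s k / 2" using kappa_pos by (simp add: field_simps)
          \<comment> \<open>The two contributions are s_k/4 and at most s_k/2.\<close>
          then have "\<kappa> * (s (Suc k) + u) \<le> s k"
            using sS[of k] s0[of k] by (simp add: distrib_left)
          then have "B y u \<subseteq> B z (s k)"
            using z B_subset_space by (intro B_subset_B) auto
          then show "\<exists>z\<in>B c R. x \<in> B z (s k)" using yu z by blast
        qed simp
        also have "\<dots> = ennreal ((1/2) ^ Suc k * W)"
          using W0 by (subst ennreal_mult[symmetric]) auto
        finally show ?case .
      qed
      note claim = this
      have "emeasure \<nu> {x\<in>B c R. lev k < w x} \<le> ennreal ((1/2) ^ k * W)"
      proof (rule claim)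
        show "{x\<in>B c R. lev k < w x} \<in> sets M" using c by simp
        fix x assume "x \<in> {x\<in>B c R. lev k < w x}"
        then have x: "x \<in> B c R" "lev k < w x" by auto
        then have "x \<in> B x (s k)" using s0 B_subset_space[of c R] by (intro centre_in_B) auto
        with x show "lev k < w x" "\<exists>z\<in>B c R. x \<in> B z (s k)" by auto
      qed
      also have "\<dots> = ennreal ((1/2) ^ k) * emeasure \<nu> V"
        unfolding W using W0 by (intro ennreal_mult) auto
      finally show ?thesis by (simp only: lev_def W_def m_def V_def)
    qed
  qed
  show ?thesis
    unfolding level_decay_def
  proof (intro exI conjI ballI allI impI)
    show "1 \<le> 3 * \<kappa>\<^sup>2" using kk by simp
    show "0 < D3" using D by simp
    show "1 < b" by fact
  qed (rule main)
qed

subsection \<open>Comparison with the three classes\<close>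

lemma weight_measure_eq: "E \<in> sets M \<Longrightarrow> weight_measure M w E = emeasure \<nu> E"
  by (simp add: weight_measure_def emeasure_\<nu>)

lemma A_infty_imp_level_decay:
  assumes "w \<in> A_infty M \<rho> \<sigma>" "1 \<le> \<sigma>"
  shows level_decay
proof -
  obtain \<sigma>1 where \<sigma>1: "1 \<le> \<sigma>1"
    and small: "\<And>\<epsilon>. 0 < \<epsilon> \<Longrightarrow> \<exists>a>0. \<forall>c\<in>space M. \<forall>r>0. emeasure \<nu> (B c (\<sigma>1 * r)) < top \<longrightarrow>
      emeasure \<nu> {x\<in>B c r. a * (measure \<nu> (B c (\<sigma>1 * r)) / measure M (B c r)) < w x}
        \<le> ennreal \<epsilon> * emeasure \<nu> (B c (\<sigma>1 * r))"
    using A_infty_small[OF assms] by blast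
  have "0 < 1 / (4 * dilation_const (\<sigma>1 * L))"
    using dilation_const_ge_1[of "\<sigma>1 * L"] by simp
  from small[OF this] obtain a where a: "0 < a"
    "\<And>c r. c \<in> space M \<Longrightarrow> 0 < r \<Longrightarrow> emeasure \<nu> (B c (\<sigma>1 * r)) < top \<Longrightarrow>
      emeasure \<nu> {x\<in>B c r. a * (measure \<nu> (B c (\<sigma>1 * r)) / measure M (B c r)) < w x}
        \<le> ennreal (1 / (4 * dilation_const (\<sigma>1 * L))) * emeasure \<nu> (B c (\<sigma>1 * r))"
    by blast
  show ?thesis by (rule small_imp_level_decay[OF \<sigma>1 a])
qed

text \<open>Enlarging \<sigma> or C raises the thresholds, and a larger \<sigma> also raises the
  bound, so both may be increased; the parameter \<open>\<sigma>0\<close> later brings \<sigma>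
  above \<kappa>.\<close>

lemma level_decayE:
  assumes level_decay
  obtains \<sigma> C b where "\<sigma>0 \<le> \<sigma>" "1 \<le> \<sigma>" "1 \<le> C" "1 < b"
    "\<And>c r k. c \<in> space M \<Longrightarrow> 0 < r \<Longrightarrow> emeasure \<nu> (B c (\<sigma> * r)) < top \<Longrightarrow>
      emeasure \<nu> {x\<in>B c r. C * b ^ k * (measure \<nu> (B c (\<sigma> * r)) / measure M (B c r)) < w x}
       \<le> ennreal ((1/2) ^ k) * emeasure \<nu> (B c (\<sigma> * r))"
proof -
  obtain \<sigma>' C' b where \<sigma>': "1 \<le> \<sigma>'" and C': "0 < C'" and b: "1 < b" and
    decay: "\<And>c r k. c \<in> space M \<Longrightarrow> 0 < r \<Longrightarrow> emeasure \<nu> (B c (\<sigma>' * r)) < top \<Longrightarrow>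
      emeasure \<nu> {x\<in>B c r. C' * b ^ k * (measure \<nu> (B c (\<sigma>' * r)) / measure M (B c r)) < w x}
       \<le> ennreal ((1/2) ^ k) * emeasure \<nu> (B c (\<sigma>' * r))"
    using assms unfolding level_decay_def by blast
  define \<sigma> where "\<sigma> = max \<sigma>0 \<sigma>'"
  define C where "C = max 1 C'"
  show thesis
  proof (rule that[of \<sigma> C b])
    show "\<sigma>0 \<le> \<sigma>" "1 \<le> \<sigma>" "1 \<le> C" "1 < b" using \<sigma>' b by (auto simp: \<sigma>_def C_def)
    fix c r and k :: nat
    assume c: "c \<in> space M" and r: "0 < (r::real)" and fin: "emeasure \<nu> (B c (\<sigma> * r)) < top"
    have sub: "B c (\<sigma>' * r) \<subseteq> B c (\<sigma> * r)" using r by (intro B_mono) (auto simp: \<sigma>_def)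
    then have le: "emeasure \<nu> (B c (\<sigma>' * r)) \<le> emeasure \<nu> (B c (\<sigma> * r))"
      using c by (intro emeasure_mono) auto
    have fin': "emeasure \<nu> (B c (\<sigma>' * r)) < top" using le fin by (rule le_less_trans)
    have "measure \<nu> (B c (\<sigma>' * r)) \<le> measure \<nu> (B c (\<sigma> * r))"
      unfolding measure_def using le fin by (intro enn2real_mono)
    then have thr: "C' * b ^ k * (measure \<nu> (B c (\<sigma>' * r)) / measure M (B c r)) \<le>
        C * b ^ k * (measure \<nu> (B c (\<sigma> * r)) / measure M (B c r))"
      using C' b by (intro mult_mono divide_right_mono) (auto simp: C_def)
    have "emeasure \<nu> {x\<in>B c r. C * b ^ k * (measure \<nu> (B c (\<sigma> * r)) / measure M (B c r)) < w x}
        \<le> emeasure \<nu> {x\<in>B c r. C' * b ^ k * (measure \<nu> (B c (\<sigma>' * r)) / measure M (B c r)) < w x}"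
      using thr c by (intro emeasure_mono) auto
    also have "\<dots> \<le> ennreal ((1/2) ^ k) * emeasure \<nu> (B c (\<sigma>' * r))"
      by (rule decay[OF c r fin'])
    also have "\<dots> \<le> ennreal ((1/2) ^ k) * emeasure \<nu> (B c (\<sigma> * r))"
      using le by (intro mult_left_mono) auto
    finally show "emeasure \<nu> {x\<in>B c r. C * b ^ k * (measure \<nu> (B c (\<sigma> * r)) / measure M (B c r)) < w x}
       \<le> ennreal ((1/2) ^ k) * emeasure \<nu> (B c (\<sigma> * r))" .
  qed
qed

lemma level_decayI:
  assumes \<sigma>: "1 \<le> \<sigma>" and C: "0 < C" and b: "1 < b"
    and decay: "\<And>c r k W. c \<in> space M \<Longrightarrow> 0 < r \<Longrightarrow> emeasure \<nu> (B c (\<sigma> * r)) = ennreal W \<Longrightarrow> 0 < W \<Longrightarrow>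
      emeasure \<nu> {x\<in>B c r. C * b ^ k * (W / measure M (B c r)) < w x} \<le> ennreal ((1/2) ^ k * W)"
  shows level_decay
  unfolding level_decay_def
proof (intro exI conjI ballI allI impI)
  fix c r and k :: nat
  assume c: "c \<in> space M" and r: "0 < (r::real)" and fin: "emeasure \<nu> (B c (\<sigma> * r)) < top"
  define W where "W = measure \<nu> (B c (\<sigma> * r))"
  have W: "emeasure \<nu> (B c (\<sigma> * r)) = ennreal W" "0 \<le> W"
    unfolding W_def using fin by (auto intro!: emeasure_eq_ennreal_measure)
  have "emeasure \<nu> {x\<in>B c r. C * b ^ k * (W / measure M (B c r)) < w x} \<le> ennreal ((1/2) ^ k * W)"
  proof (cases "W = 0")
    case True
    have "1 * r \<le> \<sigma> * r" using \<sigma> r by (intro mult_right_mono) auto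
    then have "B c r \<subseteq> B c (\<sigma> * r)" by (intro B_mono) simp
    then have "emeasure \<nu> {x\<in>B c r. C * b ^ k * (W / measure M (B c r)) < w x} \<le> emeasure \<nu> (B c (\<sigma> * r))"
      using c by (intro emeasure_mono) auto
    then show ?thesis using W True by simp
  next
    case False
    then show ?thesis using W c r by (intro decay) auto
  qed
  also have "\<dots> = ennreal ((1/2) ^ k) * ennreal W" using W by (intro ennreal_mult) auto
  finally show "emeasure \<nu> {x\<in>B c r. C * b ^ k * (measure \<nu> (B c (\<sigma> * r)) / measure M (B c r)) < w x}
       \<le> ennreal ((1/2) ^ k) * emeasure \<nu> (B c (\<sigma> * r))"
    by (simp only: W(1) W_def[symmetric])
qed (use assms in auto)

text \<open>Chebyshev's inequality gives the level set a relative measure of at most 1/(C0 b^k). The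
  choice b = 2^p turns its p-th root into the factor 2^-k, and C0 \<ge> C^p absorbs the constant of
  the hypothesis.\<close>

lemma script_A_infty_imp_level_decay:
  assumes A: "w \<in> script_A_infty M \<rho> \<sigma>" and \<sigma>: "1 \<le> \<sigma>"
  shows level_decay
proof -
  obtain C p where C: "0 < C" and p: "1 \<le> p" and AE: "\<And>c r E. c \<in> space M \<Longrightarrow> 0 < r \<Longrightarrow> E \<in> sets M \<Longrightarrow> E \<subseteq> B c r \<Longrightarrow>
      weight_measure M w E \<le> ennreal (C * (measure M E / measure M (B c r)) powr (1 / p)) *
        weight_measure M w (B c (\<sigma> * r))"
    using A unfolding script_A_infty_def by blast
  define C0 where "C0 = max 1 (C powr p)"
  define b :: real where "b = 2 powr p"
  have C0: "1 \<le> C0" "C powr p \<le> C0" by (simp_all add: C0_def)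
  have b: "1 < b" using p by (simp add: b_def)
  have CC: "C * (1 / C0) powr (1 / p) \<le> 1"
  proof -
    have "C = (C powr p) powr (1 / p)" using C p by (simp add: powr_powr)
    also have "\<dots> \<le> C0 powr (1 / p)" using C0 p by (intro powr_mono2) auto
    finally show ?thesis using C0 by (simp add: powr_divide divide_le_eq)
  qed
  have bb: "(1 / b ^ k) powr (1 / p) = (1/2) ^ k" for k
    using p by (simp add: b_def powr_divide powr_powr power_one_over flip: powr_realpow)
  show ?thesis
  proof (rule level_decayI[OF \<sigma> _ b])
    show "0 < C0" using C0 by simp
    fix c r W and k :: nat
    assume c: "c \<in> space M" and r: "0 < (r::real)" and W: "emeasure \<nu> (B c (\<sigma> * r)) = ennreal W" "0 < W"
    define m where "m = measure M (B c r)"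
    have m: "0 < m" unfolding m_def using c r by (rule measure_B_pos)
    define t where "t = C0 * b ^ k * (W / m)"
    define E where "E = {x\<in>B c r. t < w x}"
    have E: "E \<in> sets M" "E \<subseteq> B c r" using c by (auto simp: E_def)
    have t: "0 < t" using C0 b m W by (simp add: t_def)
    have "1 * r \<le> \<sigma> * r" using \<sigma> r by (intro mult_right_mono) auto
    then have "B c r \<subseteq> B c (\<sigma> * r)" by (intro B_mono) simp
    then have EW: "emeasure \<nu> E \<le> ennreal W"
      using E c unfolding W(1)[symmetric] by (intro emeasure_mono) auto
    have "emeasure M E \<le> emeasure M (B c r)" using E c by (intro emeasure_mono) auto
    then have "emeasure M E \<noteq> top" using B_finite[OF c, of r] by (auto simp: top_unique)
    then have mE: "emeasure M E = ennreal (measure M E)" by (rule emeasure_eq_ennreal_measure)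
    have "ennreal t * emeasure M E \<le> emeasure \<nu> E" using E by (intro \<nu>_ge) (auto simp: E_def)
    then have "ennreal (t * measure M E) \<le> ennreal W"
      using EW t by (simp add: mE ennreal_mult)
    then have "t * measure M E \<le> W" using W by (simp add: ennreal_le_iff)
    then have "measure M E / m \<le> 1 / C0 * (1 / b ^ k)"
      using C0 b m W by (simp add: t_def field_simps)
    then have "(measure M E / m) powr (1 / p) \<le> (1 / C0 * (1 / b ^ k)) powr (1 / p)"
      using m p by (intro powr_mono2) auto
    also have "\<dots> = (1 / C0) powr (1 / p) * (1/2) ^ k"
      using C0 b bb[of k] by (simp only: powr_mult)
    finally have "C * (measure M E / m) powr (1 / p) \<le> C * ((1 / C0) powr (1 / p) * (1/2) ^ k)"
      using C by (intro mult_left_mono) auto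
    also have "\<dots> \<le> 1 * (1/2) ^ k"
      using CC unfolding mult.assoc[symmetric] by (intro mult_right_mono) auto
    finally have le: "C * (measure M E / m) powr (1 / p) \<le> (1/2) ^ k" by simp
    have "emeasure \<nu> E \<le> ennreal (C * (measure M E / m) powr (1 / p)) * ennreal W"
      using AE[OF c r E] E c by (simp add: weight_measure_eq m_def W)
    also have "\<dots> \<le> ennreal ((1/2) ^ k) * ennreal W"
      using le by (intro mult_right_mono ennreal_leI) auto
    also have "\<dots> = ennreal ((1/2) ^ k * W)" using W by (intro ennreal_mult[symmetric]) auto
    finally show "emeasure \<nu> {x\<in>B c r. C0 * b ^ k * (W / measure M (B c r)) < w x} \<le> ennreal ((1/2) ^ k * W)"
      by (simp only: E_def t_def m_def)
  qed
qed

text \<open>With u the relative measure of \<open>E\<close>, the part below level \<open>k\<close>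
  has mass at most C b^k u W and the part above at most 2^-k W. Choosing (2b)^k \<le> 1/u <
  (2b)^(k+1) makes both of order 2^-k, and 2b = 2^p turns 2^-k into u^(1/p), up to the factor 2 lost
  between consecutive powers.\<close>

lemma level_decay_imp_script_A_infty:
  assumes level_decay
  obtains \<sigma> where "\<sigma>0 \<le> \<sigma>" "w \<in> script_A_infty M \<rho> \<sigma>"
proof -
  obtain \<sigma> C b where \<sigma>: "\<sigma>0 \<le> \<sigma>" "1 \<le> \<sigma>" and C: "1 \<le> C" and b: "1 < b" and
    decay: "\<And>c r k. c \<in> space M \<Longrightarrow> 0 < r \<Longrightarrow> emeasure \<nu> (B c (\<sigma> * r)) < top \<Longrightarrow>
      emeasure \<nu> {x\<in>B c r. C * b ^ k * (measure \<nu> (B c (\<sigma> * r)) / measure M (B c r)) < w x}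
       \<le> ennreal ((1/2) ^ k) * emeasure \<nu> (B c (\<sigma> * r))"
    by (rule level_decayE[OF assms, of \<sigma>0]) blast
  define p where "p = log 2 (2 * b)"
  have p: "1 \<le> p" using b by (simp add: p_def le_log_iff)
  have bp: "2 * b = 2 powr p" using b by (simp add: p_def)
  have bb: "(1 / (2 * b) ^ k) powr (1 / p) = (1/2) ^ k" for k
    using p by (simp add: bp powr_divide powr_powr power_one_over flip: powr_realpow)
  have "weight_measure M w E \<le> ennreal (2 * (C + 1) * (measure M E / measure M (B c r)) powr (1 / p)) *
      weight_measure M w (B c (\<sigma> * r))"
    if c: "c \<in> space M" and r: "0 < r" and E: "E \<in> sets M" "E \<subseteq> B c r" for c r E
  proof -
    define m where "m = measure M (B c r)"
    have m: "0 < m" unfolding m_def using c r by (rule measure_B_pos)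
    have EB: "emeasure M E \<le> emeasure M (B c r)" using E c by (intro emeasure_mono) auto
    then have "emeasure M E \<noteq> top" using B_finite[OF c, of r] by (auto simp: top_unique)
    then have mE: "emeasure M E = ennreal (measure M E)" by (rule emeasure_eq_ennreal_measure)
    define u where "u = measure M E / m"
    have u: "0 \<le> u" "u \<le> 1"
      using EB m unfolding mE emeasure_B[OF c] by (auto simp: u_def m_def divide_le_eq)
    have "emeasure \<nu> E \<le> ennreal (2 * (C + 1) * u powr (1 / p)) * emeasure \<nu> (B c (\<sigma> * r))"
    proof (cases "u = 0 \<or> emeasure \<nu> (B c (\<sigma> * r)) = top")
      case True
      then show ?thesis
      proof (cases "u = 0")
        case True
        then have "emeasure M E = 0" using m mE by (simp add: u_def)
        then show ?thesis using \<nu>_null[OF E(1)] by simp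
      next
        case False
        then have "0 < 2 * (C + 1) * u powr (1 / p)" using u C by simp
        then show ?thesis using True False C by (simp add: ennreal_mult_top)
      qed
    next
      case False
      then have u0: "0 < u" and fin: "emeasure \<nu> (B c (\<sigma> * r)) < top" using u by (auto simp: top.not_eq_extremum)
      define W where "W = measure \<nu> (B c (\<sigma> * r))"
      have W: "emeasure \<nu> (B c (\<sigma> * r)) = ennreal W" "0 \<le> W"
        unfolding W_def using fin by (auto intro!: emeasure_eq_ennreal_measure)
      obtain k where k: "(2 * b) ^ k \<le> 1 / u" "1 / u < (2 * b) ^ Suc k"
        using ex_power_between[of "2 * b" "1 / u"] b u u0 by auto
      define t where "t = C * b ^ k * (W / m)"
      have t: "0 \<le> t" using C b W m by (simp add: t_def)
      define F where "F = {x\<in>B c r. t < w x}"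
      have F: "F \<in> sets M" using c by (simp add: F_def)
      have "emeasure \<nu> E \<le> emeasure \<nu> ((E - F) \<union> F)" using E F by (intro emeasure_mono) auto
      also have "\<dots> \<le> emeasure \<nu> (E - F) + emeasure \<nu> F" using E F by (intro emeasure_subadditive) auto
      also have "\<dots> \<le> ennreal (t * measure M E) + ennreal ((1/2) ^ k * W)"
      proof (rule add_mono)
        have "emeasure \<nu> (E - F) \<le> ennreal t * emeasure M (E - F)"
          using E F by (intro \<nu>_le) (auto simp: F_def)
        also have "\<dots> \<le> ennreal t * emeasure M E" using E by (intro mult_left_mono emeasure_mono) auto
        finally show "emeasure \<nu> (E - F) \<le> ennreal (t * measure M E)"
          using t by (simp add: mE ennreal_mult)
        have "emeasure \<nu> F \<le> ennreal ((1/2) ^ k) * ennreal W"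
          using decay[OF c r fin, of k] by (simp only: F_def t_def m_def W_def[symmetric] W(1))
        also have "\<dots> = ennreal ((1/2) ^ k * W)" using W by (intro ennreal_mult[symmetric]) auto
        finally show "emeasure \<nu> F \<le> ennreal ((1/2) ^ k * W)" .
      qed
      also have "\<dots> = ennreal (t * measure M E + (1/2) ^ k * W)"
        using t W by (intro ennreal_plus[symmetric]) auto
      also have "t * measure M E + (1/2) ^ k * W = (C * (b ^ k * u) + (1/2) ^ k) * W"
        by (simp add: t_def u_def algebra_simps)
      also have "ennreal \<dots> \<le> ennreal (2 * (C + 1) * u powr (1 / p) * W)"
      proof (intro ennreal_leI mult_right_mono)
        have "b ^ k * u \<le> (1/2) ^ k"
          using k(1) u0 by (simp add: power_mult_distrib field_simps)
        then have 1: "C * (b ^ k * u) \<le> C * (1/2) ^ k" using C by (intro mult_left_mono) auto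
        have "1 / (2 * b) ^ Suc k \<le> u"
          using k(2) u0 b by (simp add: field_simps)
        then have "(1 / (2 * b) ^ Suc k) powr (1 / p) \<le> u powr (1 / p)"
          using p b by (intro powr_mono2) auto
        then have "(1/2) ^ k \<le> 2 * u powr (1 / p)" using bb[of "Suc k"] by simp
        then have "(C + 1) * (1/2) ^ k \<le> (C + 1) * (2 * u powr (1 / p))"
          using C by (intro mult_left_mono) auto
        then show "C * (b ^ k * u) + (1/2) ^ k \<le> 2 * (C + 1) * u powr (1 / p)"
          using 1 by (simp add: algebra_simps)
      qed (use W in simp)
      also have "\<dots> = ennreal (2 * (C + 1) * u powr (1 / p)) * ennreal W"
        using C W by (intro ennreal_mult) auto
      finally show ?thesis by (simp only: W(1))
    qed
    then show ?thesis using E c by (simp add: weight_measure_eq u_def m_def)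
  qed
  then have "w \<in> script_A_infty M \<rho> \<sigma>"
    unfolding script_A_infty_def using weight C p
    by (intro CollectI conjI exI[of _ "2 * (C + 1)"] exI[of _ p]) auto
  then show thesis using that \<sigma> by blast
qed

section \<open>Reverse Hoelder inequalities\<close>

lemma ennreal_powr_ennreal: "ennreal_powr (ennreal x) p = ennreal (max 0 x powr p)"
  by (simp add: ennreal_powr_def enn2real_ennreal max_def enn2real_eq_0_iff ennreal_neg)

text \<open>Where w > t one has w \<le> t^(1-q) w^q, so the mass there is at most t^(1-q) (CW/m)^q
  m. At t = C0 b^k W/m the choice C0 = C^(q/(q-1)) cancels the constants, and b = 2^(1/(q-1)) leaves
  2^-k W.\<close>

lemma RH_imp_level_decay:
  assumes R: "w \<in> RH M \<rho> q \<sigma>" and q: "1 < q" and \<sigma>: "1 \<le> \<sigma>"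
  shows level_decay
proof -
  obtain C' where C': "\<And>c r. c \<in> space M \<Longrightarrow> 0 < r \<Longrightarrow>
      ennreal_powr ((\<integral>\<^sup>+x\<in>B c r. ennreal (w x powr q) \<partial>M) / emeasure M (B c r)) (1 / q)
        \<le> ennreal C' * ((\<integral>\<^sup>+x\<in>B c (\<sigma> * r). ennreal (w x) \<partial>M) / emeasure M (B c (\<sigma> * r)))"
    using R unfolding RH_def by blast
  define C where "C = max 1 C'"
  have C: "1 \<le> C" "ennreal C' \<le> ennreal C" by (auto simp: C_def intro: ennreal_leI)
  define C0 where "C0 = C powr (q / (q - 1))"
  define b where "b = (2::real) powr (1 / (q - 1))"
  have b: "1 < b" using q by (simp add: b_def)
  have C0: "0 < C0" using C by (simp add: C0_def)
  have C0q: "C0 powr (1 - q) * C powr q = 1"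
  proof -
    have "q / (q - 1) * (1 - q) = - q" using q by (simp add: field_simps)
    then have "C0 powr (1 - q) = C powr (- q)" by (simp only: C0_def powr_powr)
    then show ?thesis using C by (simp add: powr_minus)
  qed
  have bb: "(b ^ k) powr (1 - q) = (1/2) ^ k" for k
  proof -
    have "(b ^ k) powr (1 - q) = 2 powr (1 / (q - 1) * k * (1 - q))"
      using b by (simp add: b_def powr_powr flip: powr_realpow)
    also have "1 / (q - 1) * k * (1 - q) = - real k" using q by (simp add: field_simps)
    also have "2 powr (- real k) = (1/2) ^ k"
      by (simp add: powr_minus powr_realpow power_one_over inverse_eq_divide)
    finally show ?thesis .
  qed
  show ?thesis
  proof (rule level_decayI[OF \<sigma> C0 b])
    fix c r W and k :: nat
    assume c: "c \<in> space M" and r: "0 < (r::real)" and W: "emeasure \<nu> (B c (\<sigma> * r)) = ennreal W" "0 < W"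
    define m where "m = measure M (B c r)"
    define n where "n = measure M (B c (\<sigma> * r))"
    define I where "I = (\<integral>\<^sup>+x\<in>B c r. ennreal (w x powr q) \<partial>M)"
    have m: "0 < m" unfolding m_def using c r by (rule measure_B_pos)
    have "1 * r \<le> \<sigma> * r" using \<sigma> r by (intro mult_right_mono) auto
    then have "B c r \<subseteq> B c (\<sigma> * r)" by (intro B_mono) simp
    then have mn: "m \<le> n" unfolding m_def n_def using c by (intro measure_B_mono)
    have "ennreal_powr (I / ennreal m) (1 / q) \<le> ennreal C' * (ennreal W / ennreal n)"
      using C'[OF c r] W c by (simp add: I_def m_def n_def emeasure_B flip: emeasure_\<nu>)
    also have "\<dots> \<le> ennreal C * (ennreal W / ennreal n)" using C by (intro mult_right_mono) auto
    also have "\<dots> = ennreal (C * (W / n))" using C W m mn by (simp add: divide_ennreal flip: ennreal_mult)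
    finally have *: "ennreal_powr (I / ennreal m) (1 / q) \<le> ennreal (C * (W / n))" .
    then have "I / ennreal m \<noteq> top" by (auto simp: ennreal_powr_def top_unique)
    then obtain j where j: "I / ennreal m = ennreal j" "0 \<le> j" by (cases "I / ennreal m") auto
    have Ij: "I = ennreal (j * m)"
    proof -
      have "I = I / ennreal m * ennreal m" using m by (simp add: ennreal_divide_times ennreal_times_divide flip: divide_ennreal)
      then show ?thesis using j m by (simp add: ennreal_mult)
    qed
    have "ennreal (j powr (1 / q)) \<le> ennreal (C * (W / n))" using * j by (simp add: ennreal_powr_ennreal max_def)
    then have "j powr (1 / q) \<le> C * (W / n)" using C W m mn by (simp add: ennreal_le_iff)
    also have "\<dots> \<le> C * (W / m)" using C W m mn by (intro mult_left_mono divide_left_mono) auto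
    finally have "(j powr (1 / q)) powr q \<le> (C * (W / m)) powr q" using q by (intro powr_mono2) auto
    then have jle: "j \<le> (C * (W / m)) powr q" using q j by (simp add: powr_powr)
    define t where "t = C0 * b ^ k * (W / m)"
    have t: "0 < t" using C0 b m W by (simp add: t_def)
    have "emeasure \<nu> {x\<in>B c r. t < w x} = (\<integral>\<^sup>+x\<in>{x\<in>B c r. t < w x}. ennreal (w x) \<partial>M)"
      using c by (intro emeasure_\<nu>) auto
    also have "\<dots> \<le> (\<integral>\<^sup>+x. ennreal (t powr (1 - q)) * (ennreal (w x powr q) * indicator (B c r) x) \<partial>M)"
    proof (intro nn_integral_mono)
      fix x assume "x \<in> space M"
      show "ennreal (w x) * indicator {x\<in>B c r. t < w x} x \<le>
          ennreal (t powr (1 - q)) * (ennreal (w x powr q) * indicator (B c r) x)"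
      proof (cases "x \<in> B c r \<and> t < w x")
        case True
        have "w x = w x powr (1 - q) * w x powr q" using True t by (simp flip: powr_add)
        also have "\<dots> \<le> t powr (1 - q) * w x powr q"
          using True t q by (intro mult_right_mono powr_mono2') auto
        finally show ?thesis using True t by (simp add: ennreal_leI flip: ennreal_mult)
      qed auto
    qed
    also have "\<dots> = ennreal (t powr (1 - q)) * I"
      unfolding I_def using c by (intro nn_integral_cmult) auto
    also have "\<dots> = ennreal (t powr (1 - q) * (j * m))" unfolding Ij using j m by (intro ennreal_mult[symmetric]) auto
    also have "\<dots> \<le> ennreal ((1/2) ^ k * W)"
    proof (rule ennreal_leI)
      have "t powr (1 - q) * (j * m) \<le> t powr (1 - q) * ((C * (W / m)) powr q * m)"
        using jle m by (intro mult_left_mono mult_right_mono) auto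
      also have "\<dots> = (C0 powr (1 - q) * C powr q) * (b ^ k) powr (1 - q) * ((W / m) powr (1 - q) * (W / m) powr q) * m"
        unfolding t_def by (simp only: powr_mult mult_ac)
      also have "(W / m) powr (1 - q) * (W / m) powr q = W / m" using W m by (simp flip: powr_add)
      finally show "t powr (1 - q) * (j * m) \<le> (1/2) ^ k * W" using C0q bb m by simp
    qed
    finally show "emeasure \<nu> {x\<in>B c r. C0 * b ^ k * (W / measure M (B c r)) < w x} \<le> ennreal ((1/2) ^ k * W)"
      by (simp only: t_def m_def)
  qed
qed

lemma level_decay_imp_RH:
  assumes level_decay
  obtains \<sigma> q where "\<sigma>0 \<le> \<sigma>" "1 < q" "w \<in> RH M \<rho> q \<sigma>"
proof -
  obtain \<sigma> C b where \<sigma>: "\<sigma>0 \<le> \<sigma>" "1 \<le> \<sigma>" and C: "1 \<le> C" and b: "1 < b" and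
    decay: "\<And>c r k. c \<in> space M \<Longrightarrow> 0 < r \<Longrightarrow> emeasure \<nu> (B c (\<sigma> * r)) < top \<Longrightarrow>
      emeasure \<nu> {x\<in>B c r. C * b ^ k * (measure \<nu> (B c (\<sigma> * r)) / measure M (B c r)) < w x}
       \<le> ennreal ((1/2) ^ k) * emeasure \<nu> (B c (\<sigma> * r))"
    by (rule level_decayE[OF assms, of \<sigma>0]) blast
  \<comment> \<open>Any growth factor b^\<epsilon> between 1 and 2 would let the decay 2^-k win; 3/2
    gives a geometric series of ratio 3/4.\<close>
  define \<epsilon> where "\<epsilon> = log b (3/2)"
  have \<epsilon>: "0 < \<epsilon>" "b powr \<epsilon> = 3/2" using b by (simp_all add: \<epsilon>_def)
  have b\<epsilon>: "(b ^ k) powr \<epsilon> = (3/2) ^ k" for k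
  proof -
    have "(b ^ k) powr \<epsilon> = (b powr \<epsilon>) ^ k"
      using b by (simp add: powr_powr mult.commute flip: powr_realpow)
    then show ?thesis using \<epsilon> by simp
  qed
  define q where "q = 1 + \<epsilon>"
  have q: "1 < q" using \<epsilon> by (simp add: q_def)
  define D where "D = dilation_const \<sigma>"
  have D: "1 \<le> D" by (simp add: D_def dilation_const_ge_1)
  \<comment> \<open>Here 7 = 1 + (3/2) * 4: the values up to the lowest level, and the series over
    the remaining levels. \<open>D\<close> converts W/m into the average over the enlarged
    ball.\<close>
  define C1 where "C1 = (7 * C powr \<epsilon>) powr (1 / q) * D"
  have C1: "0 < C1" using C D by (simp add: C1_def)
  have main: "ennreal_powr ((\<integral>\<^sup>+x\<in>B c r. ennreal (w x powr q) \<partial>M) / emeasure M (B c r)) (1 / q)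
        \<le> ennreal C1 * (emeasure \<nu> (B c (\<sigma> * r)) / emeasure M (B c (\<sigma> * r)))"
    if c: "c \<in> space M" and r: "0 < r" for c r
  proof (cases "emeasure \<nu> (B c (\<sigma> * r)) = top")
    case True
    then show ?thesis
      using C1 B_finite[OF c, of "\<sigma> * r"] by (simp add: ennreal_top_divide ennreal_mult_top)
  next
    case False
    then have fin: "emeasure \<nu> (B c (\<sigma> * r)) < top" by (simp add: top.not_eq_extremum)
    define W where "W = measure \<nu> (B c (\<sigma> * r))"
    have W: "emeasure \<nu> (B c (\<sigma> * r)) = ennreal W" "0 \<le> W"
      unfolding W_def using fin by (auto intro!: emeasure_eq_ennreal_measure)
    define m where "m = measure M (B c r)"
    have m: "0 < m" unfolding m_def using c r by (rule measure_B_pos)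
    define n where "n = measure M (B c (\<sigma> * r))"
    have "1 * r \<le> \<sigma> * r" using \<sigma> r by (intro mult_right_mono) auto
    then have sub: "B c r \<subseteq> B c (\<sigma> * r)" by (intro B_mono) simp
    then have mn: "m \<le> n" unfolding m_def n_def using c by (intro measure_B_mono)
    have nD: "n \<le> D * m" unfolding n_def m_def D_def using c r by (rule measure_dilation)
    have BW: "emeasure \<nu> (B c r) \<le> ennreal W"
      unfolding W(1)[symmetric] using sub c by (intro emeasure_mono) auto
    define I where "I = (\<integral>\<^sup>+x\<in>B c r. ennreal (w x powr q) \<partial>M)"
    have I: "I \<le> ennreal (7 * (C * (W / m)) powr \<epsilon> * W)"
    proof (cases "W = 0")
      \<comment> \<open>The levels degenerate to 0 here, so w = 0 almost everywhere on the ball is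
        used instead.\<close>
      case True
      then have "(\<integral>\<^sup>+x\<in>B c r. ennreal (w x) \<partial>M) = 0" using BW c by (simp add: emeasure_\<nu>)
      then have "AE x in M. ennreal (w x) * indicator (B c r) x = 0"
        using c by (subst (asm) nn_integral_0_iff_AE) auto
      then have "AE x in M. ennreal (w x powr q) * indicator (B c r) x = 0"
        using AE_space
        by eventually_elim (auto split: split_indicator simp: ennreal_eq_0_iff dest: w_nonneg)
      then have "I = (\<integral>\<^sup>+x. 0 \<partial>M)" unfolding I_def by (rule nn_integral_cong_AE)
      then show ?thesis by simp
    next
      case False
      then have W0: "0 < W" using W by simp
      define A where "A = C * (W / m)"
      have A: "0 < A" using C W0 m by (simp add: A_def)
      define t where "t = (\<lambda>k::nat. b ^ k * A)"
      have t: "0 < t k" for k using b A by (simp add: t_def)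
      define F where "F = (\<lambda>k. {x\<in>B c r. t k < w x})"
      have Fm: "F k \<in> sets M" for k using c by (simp add: F_def)
      have F: "emeasure \<nu> (F k) \<le> ennreal ((1/2) ^ k * W)" for k
      proof -
        have "emeasure \<nu> (F k) \<le> ennreal ((1/2) ^ k) * ennreal W"
          using decay[OF c r fin, of k] unfolding F_def t_def A_def m_def W(1) W_def[symmetric]
          by (simp add: mult_ac)
        also have "\<dots> = ennreal ((1/2) ^ k * W)" using W by (intro ennreal_mult[symmetric]) auto
        finally show ?thesis .
      qed
      have "I \<le> (\<integral>\<^sup>+x. ennreal (A powr \<epsilon>) * (ennreal (w x) * indicator (B c r) x) +
          (\<Sum>k. ennreal (t (Suc k) powr \<epsilon>) * (ennreal (w x) * indicator (F k) x)) \<partial>M)"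
        unfolding I_def
      proof (intro nn_integral_mono)
        fix x assume x: "x \<in> space M"
        define S where "S = (\<Sum>k. ennreal (t (Suc k) powr \<epsilon>) * (ennreal (w x) * indicator (F k) x))"
        show "ennreal (w x powr q) * indicator (B c r) x \<le>
            ennreal (A powr \<epsilon>) * (ennreal (w x) * indicator (B c r) x) + S"
        proof (cases "x \<in> B c r")
          case True
          have wq: "w x powr q = w x powr \<epsilon> * w x" using w_nonneg[OF x] by (simp add: q_def powr_add)
          show ?thesis
          proof (cases "w x \<le> A")
            case True
            then have "w x powr \<epsilon> * w x \<le> A powr \<epsilon> * w x"
              using w_nonneg[OF x] \<epsilon> by (intro mult_right_mono powr_mono2) auto
            then have "ennreal (w x powr q) \<le> ennreal (A powr \<epsilon>) * ennreal (w x)"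
              using w_nonneg[OF x] by (simp add: wq ennreal_leI flip: ennreal_mult)
            then show ?thesis using \<open>x \<in> B c r\<close> by (simp add: add_increasing2)
          next
            case False
            \<comment> \<open>Some level bounds \<open>w x\<close> from above; the one just before
              the first such level is the \<open>k\<close> whose term dominates the
              integrand.\<close>
            obtain n where "w x / A < b ^ n" using real_arch_pow[OF b] by blast
            then have "w x \<le> t n" using A by (simp add: t_def field_simps)
            then obtain k where k: "t k < w x" "w x \<le> t (Suc k)"
              using ex_least_nat_less[of "\<lambda>n. w x \<le> t n" n] False by (auto simp: t_def not_le)
            have "w x powr \<epsilon> * w x \<le> t (Suc k) powr \<epsilon> * w x"
              using w_nonneg[OF x] \<epsilon> k by (intro mult_right_mono powr_mono2) auto
            then have "ennreal (w x powr q) \<le> ennreal (t (Suc k) powr \<epsilon>) * (ennreal (w x) * indicator (F k) x)"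
              using w_nonneg[OF x] k \<open>x \<in> B c r\<close> by (simp add: F_def wq ennreal_leI flip: ennreal_mult)
            also have "\<dots> = (\<Sum>i\<in>{k}. ennreal (t (Suc i) powr \<epsilon>) * (ennreal (w x) * indicator (F i) x))"
              by simp
            also have "\<dots> \<le> S" unfolding S_def by (intro sum_le_suminf) auto
            finally show ?thesis using \<open>x \<in> B c r\<close> by (simp add: add_increasing)
          qed
        qed simp
      qed
      also have "\<dots> = ennreal (A powr \<epsilon>) * emeasure \<nu> (B c r) + (\<Sum>k. ennreal (t (Suc k) powr \<epsilon>) * emeasure \<nu> (F k))"
        using c Fm by (simp add: nn_integral_add nn_integral_cmult nn_integral_suminf emeasure_\<nu>)
      also have "\<dots> \<le> ennreal (A powr \<epsilon>) * ennreal W + (\<Sum>k. ennreal (A powr \<epsilon> * W * (3/2) * (3/4) ^ k))"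
      proof (intro add_mono mult_left_mono BW suminf_le)
        fix k
        have "ennreal (t (Suc k) powr \<epsilon>) * emeasure \<nu> (F k) \<le> ennreal (t (Suc k) powr \<epsilon>) * ennreal ((1/2) ^ k * W)"
          using F by (intro mult_left_mono) auto
        also have "\<dots> = ennreal (t (Suc k) powr \<epsilon> * ((1/2) ^ k * W))" using W by (intro ennreal_mult[symmetric]) auto
        also have "t (Suc k) powr \<epsilon> * ((1/2) ^ k * W) = A powr \<epsilon> * W * (3/2) * (3/4) ^ k"
        proof -
          have "t (Suc k) powr \<epsilon> = (3/2) ^ Suc k * A powr \<epsilon>"
            unfolding t_def using b A b\<epsilon>[of "Suc k"] by (subst powr_mult) auto
          then have "t (Suc k) powr \<epsilon> * ((1/2) ^ k * W) = A powr \<epsilon> * W * (3/2) * ((3/2) ^ k * (1/2) ^ k)"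
            by (simp only: power_Suc mult_ac)
          also have "(3/2) ^ k * (1/2) ^ k = (3/4 :: real) ^ k" by (simp flip: power_mult_distrib)
          finally show ?thesis .
        qed
        finally show "ennreal (t (Suc k) powr \<epsilon>) * emeasure \<nu> (F k) \<le> ennreal (A powr \<epsilon> * W * (3/2) * (3/4) ^ k)" .
      qed auto
      also have "(\<Sum>k. ennreal (A powr \<epsilon> * W * (3/2) * (3/4) ^ k)) = ennreal (A powr \<epsilon> * W * (3/2) * 4)"
      proof (rule suminf_ennreal_eq)
        show "(\<lambda>k. A powr \<epsilon> * W * (3/2) * (3/4) ^ k) sums (A powr \<epsilon> * W * (3/2) * 4)"
          using sums_mult[OF geometric_sums[of "3/4::real"], of "A powr \<epsilon> * W * (3/2)"] by simp
      qed (use W in auto)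
      also have "ennreal (A powr \<epsilon>) * ennreal W + ennreal (A powr \<epsilon> * W * (3/2) * 4) =
          ennreal (A powr \<epsilon> * W + A powr \<epsilon> * W * (3/2) * 4)"
        using W by (subst ennreal_plus) (auto simp: ennreal_mult)
      also have "A powr \<epsilon> * W + A powr \<epsilon> * W * (3/2) * 4 = 7 * A powr \<epsilon> * W" by simp
      finally show ?thesis by (simp only: A_def)
    qed
    have "I / ennreal m \<le> ennreal (7 * (C * (W / m)) powr \<epsilon> * W) / ennreal m"
      using I by (intro divide_right_mono_ennreal)
    also have "\<dots> = ennreal (7 * (C * (W / m)) powr \<epsilon> * W / m)" using W m by (intro divide_ennreal) auto
    finally have Im: "I / ennreal m \<le> ennreal (7 * (C * (W / m)) powr \<epsilon> * W / m)" .
    then obtain j where j: "I / ennreal m = ennreal j" "0 \<le> j"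
      by (cases "I / ennreal m") (auto simp: top_unique)
    then have "j \<le> 7 * (C * (W / m)) powr \<epsilon> * W / m" using Im W m by (simp add: ennreal_le_iff)
    also have "\<dots> = 7 * C powr \<epsilon> * (W / m) powr q"
    proof -
      have "(W / m) powr q = W / m * (W / m) powr \<epsilon>" using W m by (simp only: q_def powr_add) simp
      then show ?thesis by (simp only: powr_mult) simp
    qed
    finally have "j powr (1 / q) \<le> (7 * C powr \<epsilon> * (W / m) powr q) powr (1 / q)"
      using j q by (intro powr_mono2) auto
    also have "\<dots> = (7 * C powr \<epsilon>) powr (1 / q) * (W / m)"
      using C W m q by (simp add: powr_mult powr_powr)
    also have "\<dots> \<le> (7 * C powr \<epsilon>) powr (1 / q) * (D * (W / n))"
    proof (intro mult_left_mono)
      have "W * n \<le> W * (D * m)" using W nD by (intro mult_left_mono)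
      then show "W / m \<le> D * (W / n)" using m mn by (simp add: field_simps)
    qed auto
    finally have "j powr (1 / q) \<le> C1 * (W / n)" by (simp add: C1_def mult_ac)
    then have "ennreal_powr (I / ennreal m) (1 / q) \<le> ennreal (C1 * (W / n))"
      using j by (simp add: ennreal_powr_ennreal max_def ennreal_leI)
    also have "\<dots> = ennreal C1 * (ennreal W / ennreal n)"
      using C1 W m mn by (simp add: divide_ennreal flip: ennreal_mult)
    finally show ?thesis by (simp only: I_def m_def n_def W(1) emeasure_B[OF c])
  qed
  have "w \<in> RH M \<rho> q \<sigma>"
    unfolding RH_def using weight main
    by (intro CollectI conjI exI[of _ C1]) (auto simp: emeasure_\<nu>)
  then show thesis using that \<sigma> q by blast
qed

section \<open>The maximal function under level decay\<close>

text \<open>The level sets of the maximal function need not be measurable, hence the set \<open>U\<close>.\<close>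

lemma maximal_weak_type:
  assumes c: "c \<in> space M" and R: "0 < R" and t: "0 < t"
    and top: "ennreal (dilation_const (3 * \<kappa>\<^sup>2)) * emeasure \<nu> (B c R) \<le> ennreal t * emeasure M (B c R)"
  obtains U where "U \<in> sets M"
    "{x\<in>B c R. ennreal t < maximal M \<rho> (\<lambda>y. indicator (B c R) y * w y) x} \<subseteq> U"
    "emeasure M U \<le> ennreal (2 * dilation_const L / t) * emeasure \<nu> {x\<in>B c R. t / 2 < w x}"
proof -
  define V where "V = B c R"
  define D where "D = dilation_const (3 * \<kappa>\<^sup>2)"
  define D1 where "D1 = dilation_const L"
  have D: "1 \<le> D" "1 \<le> D1" by (simp_all add: D_def D1_def dilation_const_ge_1)
  have L: "5 \<le> L" by (rule vitali_const_ge)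
  have V: "V \<in> sets M" using c by (simp add: V_def)
  define F where "F = {(y, s). y \<in> space M \<and> 0 < s \<and> B y s \<inter> V \<noteq> {} \<and>
    ennreal t * emeasure M (B y s) < emeasure \<nu> (V \<inter> B y s)}"
  have kk: "\<kappa> \<le> \<kappa>\<^sup>2" using kappa_ge_1 by (intro self_le_power) auto
  have k3: "\<kappa> * (2 * \<kappa> * s + s) \<le> 3 * \<kappa>\<^sup>2 * s" if "0 < s" for s
  proof -
    have "\<kappa> * s \<le> \<kappa>\<^sup>2 * s" using kk that by (intro mult_right_mono) auto
    then show ?thesis by (simp add: power2_eq_square algebra_simps)
  qed
  have F: "y \<in> space M" "0 < s" "s \<le> R" "B y s \<subseteq> B c (3 * \<kappa>\<^sup>2 * R)" if ysF: "(y, s) \<in> F" for y s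
  proof -
    show ys: "y \<in> space M" "0 < s" using ysF by (auto simp: F_def)
    obtain u where u: "u \<in> B y s" "u \<in> B c R" using ysF by (auto simp: F_def V_def)
    have u': "u \<in> space M" "y \<in> B u s" "c \<in> B u R" using u ys c B_sym by blast+
    \<comment> \<open>A larger ball meeting \<open>V\<close> contains \<open>V\<close> after
      dilation by 3\<kappa>^2, so the mass hypothesis bounds its average by \<open>t\<close>, and it
      cannot belong to \<open>F\<close>.\<close>
    show sR: "s \<le> R"
    proof (rule ccontr)
      assume "\<not> s \<le> R"
      then have "R \<le> s" by simp
      then have "u \<in> B c s" "c \<in> B u s" using u u' B_mono[of R s] by blast+
      moreover have "B u s \<subseteq> B y (2 * \<kappa> * s)"
        using u ys by (intro B_subset_B[where d = s]) auto
      ultimately have "c \<in> B y (2 * \<kappa> * s)" by blast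
      then have "B c s \<subseteq> B y (3 * \<kappa>\<^sup>2 * s)" using ys k3 by (intro B_subset_B) auto
      then have "V \<subseteq> B y (3 * \<kappa>\<^sup>2 * s)" using B_mono[OF \<open>R \<le> s\<close>] by (auto simp: V_def)
      then have "emeasure M V \<le> emeasure M (B y (3 * \<kappa>\<^sup>2 * s))"
        using ys by (intro emeasure_mono) auto
      also have "\<dots> \<le> ennreal D * emeasure M (B y s)"
        unfolding D_def using ys by (rule emeasure_dilation)
      finally have "ennreal t * emeasure M V \<le> ennreal t * (ennreal D * emeasure M (B y s))"
        by (intro mult_left_mono) auto
      with top have "ennreal D * emeasure \<nu> V \<le> ennreal t * (ennreal D * emeasure M (B y s))"
        unfolding D_def V_def by (rule order.trans)
      also have "\<dots> = ennreal D * (ennreal t * emeasure M (B y s))"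
        by (rule mult.left_commute)
      finally have "emeasure \<nu> V \<le> ennreal t * emeasure M (B y s)"
        using D by (subst (asm) ennreal_mult_le_mult_iff) auto
      moreover have "emeasure \<nu> (V \<inter> B y s) \<le> emeasure \<nu> V" using V by (intro emeasure_mono) auto
      ultimately have "emeasure \<nu> (V \<inter> B y s) \<le> ennreal t * emeasure M (B y s)"
        by (rule order.trans[rotated])
      then show False using ysF by (auto simp: F_def)
    qed
    have "B y s \<subseteq> B y R" using sR by (rule B_mono)
    also have "\<dots> \<subseteq> B c (3 * \<kappa>\<^sup>2 * R)"
    proof (rule B_subset_B[OF c _ k3[OF R]])
      have "y \<in> B u R" using u' sR B_mono[of s R] by blast
      moreover have "B u R \<subseteq> B c (2 * \<kappa> * R)" using c u by (intro B_subset_B[where d = R]) auto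
      ultimately show "y \<in> B c (2 * \<kappa> * R)" by blast
    qed
    finally show "B y s \<subseteq> B c (3 * \<kappa>\<^sup>2 * R)" .
  qed
  have W: "B c (3 * \<kappa>\<^sup>2 * R) \<in> sets M" "emeasure M (B c (3 * \<kappa>\<^sup>2 * R)) < \<infinity>"
    using c B_finite[of c] by auto
  obtain G where G: "G \<subseteq> F" "countable G" "disjoint_family_on (\<lambda>(c, r). B c r) G"
    "\<And>y s. (y, s) \<in> F \<Longrightarrow> \<exists>(y', s')\<in>G. B y s \<subseteq> B y' (L * s')"
    by (rule vitali_covering[OF F W, of F]) (blast intro: that)+
  define U where "U = (\<Union>p\<in>G. B (fst p) (L * snd p))"
  have U: "U \<in> sets M"
    unfolding U_def using G(1,2) F(1) by (intro sets.countable_UN') auto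
  \<comment> \<open>Averages above \<open>t\<close> leave at least half the mass where w > t/2.
    Charging only this part bounds \<open>U\<close> by a level set, to which the decay applies,
    rather than by all of \<open>V\<close>.\<close>
  define Z where "Z = (\<lambda>p::'a \<times> real. {x\<in>V \<inter> B (fst p) (snd p). t / 2 < w x})"
  show thesis
  proof (rule that[OF U])
    show "{x\<in>B c R. ennreal t < maximal M \<rho> (\<lambda>y. indicator (B c R) y * w y) x} \<subseteq> U"
    proof
      fix x assume "x \<in> {x\<in>B c R. ennreal t < maximal M \<rho> (\<lambda>y. indicator (B c R) y * w y) x}"
      then have x: "x \<in> V" "ennreal t < maximal M \<rho> (\<lambda>y. indicator V y * w y) x" by (auto simp: V_def)
      then obtain y s where ys: "y \<in> space M" "0 < s" "x \<in> B y s"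
        "ennreal t < emeasure \<nu> (V \<inter> B y s) / emeasure M (B y s)"
        unfolding maximal_eq[OF V] less_SUP_iff by auto
      have "ennreal t * emeasure M (B y s) < emeasure \<nu> (V \<inter> B y s)"
      proof (rule ccontr)
        assume "\<not> ennreal t * emeasure M (B y s) < emeasure \<nu> (V \<inter> B y s)"
        then have "emeasure \<nu> (V \<inter> B y s) \<le> emeasure M (B y s) * ennreal t"
          by (simp add: mult.commute not_less)
        then have "emeasure \<nu> (V \<inter> B y s) / emeasure M (B y s) \<le> ennreal t"
          using ball_pos[OF ys(1,2)] by (intro divide_le_posI_ennreal) auto
        then show False using ys by simp
      qed
      then have "(y, s) \<in> F" using ys x by (auto simp: F_def)
      from G(4)[OF this] show "x \<in> U" using ys by (force simp: U_def)
    qed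
    have "emeasure M U \<le> ennreal (2 * D1 / t) * emeasure \<nu> (\<Union>p\<in>G. Z p)"
      unfolding U_def
    proof (rule emeasure_UN_le_disjoint[OF G(2)])
      show "disjoint_family_on Z G"
        using G(3) unfolding Z_def disjoint_family_on_def case_prod_unfold by blast
      fix p assume "p \<in> G"
      then obtain y s where p: "p = (y, s)" "(y, s) \<in> F" using G(1) by (cases p) auto
      note ys = F(1,2)[OF p(2)]
      show "B (fst p) (L * snd p) \<in> sets M" "Z p \<in> sets \<nu>" using ys V by (auto simp: p Z_def)
      have "emeasure M (B y (L * s)) \<le> ennreal D1 * emeasure M (B y s)"
        unfolding D1_def using ys by (rule emeasure_dilation)
      also have "\<dots> = ennreal (2 * D1 / t * (t / 2)) * emeasure M (B y s)" using t by simp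
      also have "\<dots> = ennreal (2 * D1 / t) * (ennreal (t / 2) * emeasure M (B y s))"
        using t D by (subst ennreal_mult) (auto simp: mult.assoc)
      also have "\<dots> \<le> ennreal (2 * D1 / t) * emeasure \<nu> (Z p)"
        unfolding Z_def p(1) fst_conv snd_conv using ys V t p(2) B_finite[OF ys(1)]
        by (intro mult_left_mono half_mass_above_level emeasure_mono) (auto simp: F_def intro: less_imp_le)
      finally show "emeasure M (B (fst p) (L * snd p)) \<le> ennreal (2 * D1 / t) * emeasure \<nu> (Z p)"
        by (simp add: p)
    qed
    also have "\<dots> \<le> ennreal (2 * D1 / t) * emeasure \<nu> {x\<in>V. t / 2 < w x}"
      using V by (intro mult_left_mono emeasure_mono) (auto simp: Z_def)
    finally show "emeasure M U \<le> ennreal (2 * dilation_const L / t) * emeasure \<nu> {x\<in>B c R. t / 2 < w x}"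
      by (simp only: D1_def V_def)
  qed
qed

text \<open>The maximal function is at most t_0 plus the sum of t_(k+1) over the sets U_k containing
  the point. By the weak type inequality and the decay, U_k has measure at most (2 D1 / t_k) 2^-k W,
  and t_(k+1) = b t_k, so the integral is bounded by a geometric series.\<close>

lemma level_decay_imp_A_infty:
  assumes level_decay
  obtains \<sigma> where "\<sigma>0 \<le> \<sigma>" "w \<in> A_infty M \<rho> \<sigma>"
proof -
  obtain \<sigma> C b where \<sigma>: "\<sigma>0 \<le> \<sigma>" "1 \<le> \<sigma>" and C: "1 \<le> C" and b: "1 < b" and
    decay: "\<And>c r k. c \<in> space M \<Longrightarrow> 0 < r \<Longrightarrow> emeasure \<nu> (B c (\<sigma> * r)) < top \<Longrightarrow>
      emeasure \<nu> {x\<in>B c r. C * b ^ k * (measure \<nu> (B c (\<sigma> * r)) / measure M (B c r)) < w x}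
       \<le> ennreal ((1/2) ^ k) * emeasure \<nu> (B c (\<sigma> * r))"
    by (rule level_decayE[OF assms, of \<sigma>0]) blast
  define D where "D = dilation_const (3 * \<kappa>\<^sup>2)"
  define D1 where "D1 = dilation_const L"
  have D: "1 \<le> D" "1 \<le> D1" by (simp_all add: D_def D1_def dilation_const_ge_1)
  \<comment> \<open>The first summand comes from \<open>t 0\<close> on the whole ball, the second
    from the series of 2 D1 b 2^-k.\<close>
  define C1 where "C1 = 2 * C * D + 4 * D1 * b"
  have C1: "0 < C1" using C D b by (simp add: C1_def add_pos_pos)
  have main: "(\<integral>\<^sup>+x\<in>B c r. maximal M \<rho> (\<lambda>y. indicator (B c r) y * w y) x \<partial>M)
      \<le> ennreal C1 * emeasure \<nu> (B c (\<sigma> * r))"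
    if c: "c \<in> space M" and r: "0 < r" for c r
  proof (cases "emeasure \<nu> (B c (\<sigma> * r)) = top")
    case True
    then show ?thesis using C1 by (simp add: ennreal_mult_top)
  next
    case False
    then have fin: "emeasure \<nu> (B c (\<sigma> * r)) < top" by (simp add: top.not_eq_extremum)
    define W where "W = measure \<nu> (B c (\<sigma> * r))"
    have W: "emeasure \<nu> (B c (\<sigma> * r)) = ennreal W" "0 \<le> W"
      unfolding W_def using fin by (auto intro!: emeasure_eq_ennreal_measure)
    define m where "m = measure M (B c r)"
    have m: "0 < m" unfolding m_def using c r by (rule measure_B_pos)
    define V where "V = B c r"
    have V: "V \<in> sets M" using c by (simp add: V_def)
    have "1 * r \<le> \<sigma> * r" using \<sigma> r by (intro mult_right_mono) auto
    then have BW: "emeasure \<nu> V \<le> ennreal W"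
      unfolding W(1)[symmetric] V_def using c by (intro emeasure_mono B_mono) auto
    define f where "f = maximal M \<rho> (\<lambda>y. indicator V y * w y)"
    have "(\<integral>\<^sup>+x\<in>V. f x \<partial>M) \<le> ennreal (C1 * W)"
    proof (cases "W = 0")
      case True
      have "emeasure \<nu> (V \<inter> B y s) = 0" for y s
        using emeasure_mono[of "V \<inter> B y s" V \<nu>] V BW True by simp
      then have "f x = 0" for x
        unfolding f_def maximal_eq[OF V] by (auto intro!: SUP_eq_const simp: SUP_constant bot_ennreal)
      then show ?thesis by simp
    next
      case False
      then have W0: "0 < W" using W by simp
      \<comment> \<open>The factor 2 offsets the t/2 in \<open>maximal_weak_type\<close>, and
        \<open>D\<close> supplies its mass hypothesis.\<close>
      define t where "t = (\<lambda>k::nat. 2 * (C * D * b ^ k * (W / m)))"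
      have t: "0 < t k" for k using C D b W0 m by (simp add: t_def)
      have tS: "t (Suc k) = b * t k" for k by (simp add: t_def)
      have half: "emeasure \<nu> {x\<in>V. t k / 2 < w x} \<le> ennreal ((1/2) ^ k * W)" for k
      proof -
        have "C * 1 \<le> C * D" using C D by (intro mult_left_mono) auto
        then have "C * b ^ k * (W / m) \<le> t k / 2"
          unfolding t_def using b W m by (simp add: mult_right_mono divide_right_mono)
        then have "{x\<in>V. t k / 2 < w x} \<subseteq> {x\<in>V. C * b ^ k * (W / m) < w x}"
          by (blast intro: le_less_trans)
        then have "emeasure \<nu> {x\<in>V. t k / 2 < w x} \<le> emeasure \<nu> {x\<in>V. C * b ^ k * (W / m) < w x}"
          using V by (intro emeasure_mono) auto
        also have "\<dots> \<le> ennreal ((1/2) ^ k) * ennreal W"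
          using decay[OF c r fin, of k] by (simp only: V_def m_def W_def[symmetric] W(1))
        also have "\<dots> = ennreal ((1/2) ^ k * W)" using W by (intro ennreal_mult[symmetric]) auto
        finally show ?thesis .
      qed
      have "\<exists>U. U \<in> sets M \<and> {x\<in>V. ennreal (t k) < f x} \<subseteq> U \<and>
        emeasure M U \<le> ennreal (2 * D1 / t k) * emeasure \<nu> {x\<in>V. t k / 2 < w x}" for k
      proof -
        have "D * W \<le> t k * m"
        proof -
          have "1 \<le> C * b ^ k" using C b by (intro mult_ge1_I) auto
          then have "D * W * 1 \<le> D * W * (2 * (C * b ^ k))" using D W by (intro mult_left_mono) auto
          then show ?thesis using m by (simp add: t_def mult_ac)
        qed
        then have "ennreal D * ennreal W \<le> ennreal (t k) * ennreal m"
          using D W t[of k] m by (simp add: ennreal_leI flip: ennreal_mult)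
        moreover have "ennreal D * emeasure \<nu> V \<le> ennreal D * ennreal W" using BW by (intro mult_left_mono) auto
        ultimately have top: "ennreal D * emeasure \<nu> (B c r) \<le> ennreal (t k) * emeasure M (B c r)"
          unfolding emeasure_B[OF c] m_def V_def by (rule order.trans[rotated])
        show ?thesis
          unfolding V_def D1_def f_def
          by (rule maximal_weak_type[OF c r t[of k] top[unfolded D_def]]) blast
      qed
      then obtain U where U: "\<And>k. U k \<in> sets M" "\<And>k x. x \<in> V \<Longrightarrow> ennreal (t k) < f x \<Longrightarrow> x \<in> U k"
        and MU: "\<And>k. emeasure M (U k) \<le> ennreal (2 * D1 / t k) * emeasure \<nu> {x\<in>V. t k / 2 < w x}"
        unfolding subset_iff mem_Collect_eq by metis
      have "(\<integral>\<^sup>+x\<in>V. f x \<partial>M) \<le> (\<integral>\<^sup>+x. ennreal (t 0) * indicator V x +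
          (\<Sum>k. ennreal (t (Suc k)) * indicator (U k) x) \<partial>M)"
      proof (intro nn_integral_mono)
        fix x
        define S where "S = (\<Sum>k. ennreal (t (Suc k)) * indicator (U k) x)"
        have S: "ennreal (t (Suc k)) \<le> S" if "x \<in> U k" for k
        proof -
          have "(\<Sum>i\<in>{k}. ennreal (t (Suc i)) * indicator (U i) x) \<le> S"
            unfolding S_def by (intro sum_le_suminf) auto
          then show ?thesis using that by simp
        qed
        have "f x \<le> ennreal (t 0) + S" if x: "x \<in> V"
        proof (cases "\<exists>n. f x \<le> ennreal (t n)")
          case True
          then obtain n where n: "f x \<le> ennreal (t n)" by blast
          show ?thesis
          proof (cases "f x \<le> ennreal (t 0)")
            case False
            then obtain k where "\<not> f x \<le> ennreal (t k)" "f x \<le> ennreal (t (Suc k))"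
              using ex_least_nat_less[of "\<lambda>n. f x \<le> ennreal (t n)", OF n] by blast
            then have "f x \<le> S" using S[of k] U(2)[OF x, of k] by (auto simp: not_le)
            then show ?thesis by (simp add: add_increasing)
          qed (simp add: add_increasing2)
        next
          \<comment> \<open>The maximal function may be infinite at a point; such a point lies in
            every \<open>U k\<close>, and the majorant is infinite there as well.\<close>
          case False
          then have "x \<in> U k" for k using U(2)[OF x] by (simp add: not_le)
          then have tS: "ennreal (t (Suc k)) \<le> S" for k using S by blast
          have "S = top"
          proof (rule ccontr)
            assume "S \<noteq> top"
            then obtain s where s: "S = ennreal s" "0 \<le> s" by (cases S) auto
            obtain k where k: "s / t 0 < b ^ k" using real_arch_pow[OF b] by blast
            have "s < t 0 * b ^ k" using k t[of 0] by (simp add: field_simps)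
            also have "\<dots> = t k" by (simp add: t_def)
            also have "\<dots> \<le> t (Suc k)" using b t[of k] by (simp add: \<open>\<And>k. t (Suc k) = b * t k\<close>)
            finally show False using tS[of k] s by (simp add: ennreal_le_iff)
          qed
          then show ?thesis by simp
        qed
        then show "f x * indicator V x \<le> ennreal (t 0) * indicator V x + S"
          by (auto split: split_indicator)
      qed
      also have "\<dots> = ennreal (t 0) * emeasure M V + (\<Sum>k. ennreal (t (Suc k)) * emeasure M (U k))"
        using V U by (simp add: nn_integral_add nn_integral_cmult_indicator nn_integral_suminf)
      also have "\<dots> \<le> ennreal (2 * C * D * W) + (\<Sum>k. ennreal (2 * D1 * b * W * (1/2) ^ k))"
      proof (intro add_mono suminf_le)
        have "ennreal (t 0) * emeasure M V = ennreal (t 0 * m)"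
          unfolding V_def emeasure_B[OF c] using t[of 0] m by (simp add: m_def ennreal_mult)
        then show "ennreal (t 0) * emeasure M V \<le> ennreal (2 * C * D * W)" using m by (simp add: t_def mult_ac)
        fix k
        have "ennreal (t (Suc k)) * emeasure M (U k) \<le>
            ennreal (t (Suc k)) * (ennreal (2 * D1 / t k) * ennreal ((1/2) ^ k * W))"
          using half by (intro mult_left_mono order.trans[OF MU]) auto
        also have "\<dots> = ennreal (t (Suc k) * (2 * D1 / t k * ((1/2) ^ k * W)))"
          using t[of k] t[of "Suc k"] D W by (simp flip: ennreal_mult)
        also have "t (Suc k) * (2 * D1 / t k * ((1/2) ^ k * W)) = 2 * D1 * b * W * (1/2) ^ k"
          using t[of k] unfolding tS by simp
        finally show "ennreal (t (Suc k)) * emeasure M (U k) \<le> ennreal (2 * D1 * b * W * (1/2) ^ k)" .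
      qed auto
      also have "(\<Sum>k. ennreal (2 * D1 * b * W * (1/2) ^ k)) = ennreal (2 * D1 * b * W * 2)"
      proof (rule suminf_ennreal_eq)
        show "(\<lambda>k. 2 * D1 * b * W * (1/2) ^ k) sums (2 * D1 * b * W * 2)"
          using sums_mult[OF geometric_sums[of "1/2::real"], of "2 * D1 * b * W"] by simp
      qed (use W D b in auto)
      also have "ennreal (2 * C * D * W) + ennreal (2 * D1 * b * W * 2) = ennreal (2 * C * D * W + 2 * D1 * b * W * 2)"
        using W D b C by (intro ennreal_plus[symmetric]) auto
      also have "2 * C * D * W + 2 * D1 * b * W * 2 = C1 * W" by (simp add: C1_def algebra_simps)
      finally show ?thesis .
    qed
    also have "\<dots> = ennreal C1 * ennreal W" using C1 W by (intro ennreal_mult) auto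
    finally show ?thesis by (simp only: f_def V_def W(1))
  qed
  have "w \<in> A_infty M \<rho> \<sigma>"
    unfolding A_infty_def using weight main
    by (intro CollectI conjI exI[of _ C1]) (auto simp: weight_measure_eq)
  then show thesis using that \<sigma> by blast
qed

end

section \<open>Equivalence of the three conditions\<close>

theorem theorem8p4:
  fixes M :: "'a measure" and \<rho> :: "'a \<Rightarrow> 'a \<Rightarrow> real" and \<kappa> :: real and w :: "'a \<Rightarrow> real"
  assumes "homogeneous_type M \<rho> \<kappa>"
    and "weight M w"
  shows "(w \<in> A_infty_weak M \<rho> \<kappa> \<longleftrightarrow> w \<in> script_A_infty_weak M \<rho> \<kappa>)
    \<and> (w \<in> script_A_infty_weak M \<rho> \<kappa> \<longleftrightarrow> (\<exists>q>1. w \<in> RH_weak M \<rho> \<kappa> q))"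
proof -
  interpret weighted_homogeneous_type M \<rho> \<kappa> w
    using assms by (simp add: weighted_homogeneous_type_def weighted_homogeneous_type_axioms_def)
  have \<sigma>: "1 \<le> \<sigma>" if "\<kappa> < \<sigma>" for \<sigma> using that kappa_ge_1 by simp
  have "w \<in> A_infty_weak M \<rho> \<kappa> \<longleftrightarrow> level_decay"
  proof
    assume level_decay
    \<comment> \<open>Asking for \<kappa> + 1 as the lower bound makes \<sigma> strictly larger than
      \<kappa>, as the weak classes require.\<close>
    then obtain \<sigma> where "\<kappa> + 1 \<le> \<sigma>" "w \<in> A_infty M \<rho> \<sigma>" by (rule level_decay_imp_A_infty)
    then show "w \<in> A_infty_weak M \<rho> \<kappa>" by (auto simp: A_infty_weak_def intro!: bexI[of _ \<sigma>])
  qed (use A_infty_imp_level_decay \<sigma> in \<open>auto simp: A_infty_weak_def\<close>)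
  moreover have "w \<in> script_A_infty_weak M \<rho> \<kappa> \<longleftrightarrow> level_decay"
  proof
    assume level_decay
    then obtain \<sigma> where "\<kappa> + 1 \<le> \<sigma>" "w \<in> script_A_infty M \<rho> \<sigma>" by (rule level_decay_imp_script_A_infty)
    then show "w \<in> script_A_infty_weak M \<rho> \<kappa>" by (auto simp: script_A_infty_weak_def intro!: bexI[of _ \<sigma>])
  qed (use script_A_infty_imp_level_decay \<sigma> in \<open>auto simp: script_A_infty_weak_def\<close>)
  moreover have "(\<exists>q>1. w \<in> RH_weak M \<rho> \<kappa> q) \<longleftrightarrow> level_decay"
  proof
    assume level_decay
    then obtain \<sigma> q where "\<kappa> + 1 \<le> \<sigma>" "1 < q" "w \<in> RH M \<rho> q \<sigma>" by (rule level_decay_imp_RH)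
    then show "\<exists>q>1. w \<in> RH_weak M \<rho> \<kappa> q"
      by (auto simp: RH_weak_def intro!: exI[of _ q] bexI[of _ \<sigma>])
  qed (use RH_imp_level_decay \<sigma> in \<open>auto simp: RH_weak_def\<close>)
  ultimately show ?thesis by blast
qed

end
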